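(* Let $\boldsymbol f_1,\dots,\boldsymbol f_n$ be a basis of $\mathbb R^n$, let $M=(m_{jk})$ be the matrix with columns $\boldsymbol f_1,\dots,\boldsymbol f_n$, and let $\mathcal L$, $B$, $\tau_B$, $U_n(t)$, $U_J(t)$ be as in the context. Assume that the off-diagonal entries of $M$ and $M^{-1}$ are uniformly $O(n^{-1})$ and the diagonal entries of $M$ and $M^{-1}$ are uniformly $\Theta(1)$. Assume that $\zeta,\rho>0$ are sufficiently small. Let $H:\mathbb R^n\to\mathbb C$ be an absolutely integrable (over a basic cell) $\mathcal L$-periodic function, that is, $H(\boldsymbol x)=H(\tau_B(\boldsymbol x))$. Let $B_{\mathrm{abs}}$ be such that $$\Bigl\{(x_1,\dots,x_n)\in B:\ \sum_{j=1}^n|x_j|\,\mathbf 1_{|x_j|>\rho/3}>\tfrac13\zeta n\rho\Bigr\}\subseteq B_{\mathrm{abs}}\subseteq B$$ and $B_{\mathrm{abs}}\cap S$ is measurable within $S$ for any affine subspace $S$ of $\mathbb R^n$. Suppose that there is a function $L:[n]\to\mathbb R_+$ such that $$\left|\int_WH(\boldsymbol w+\boldsymbol y)\,d\boldsymbol y\right|\le L(|J|)$$ for every $J\subseteq[n]$ with $1\le|J|\le n$, every axis-aligned cuboid $W$ such that $U_J(\tfrac13\rho)\subseteq W\subseteq U_J(\tfrac43\rho)$, and every $\boldsymbol w=(w_1,\dots,w_n)^{\mathsf T}\in(B+U_n(\tfrac13\rho))\cap\operatorname{span}\{\boldsymbol e_j:j\in J\}$ such that (i) $|w_j|>\dfrac{\rho\,m_{jj}}{9\max_{k\in[n]}m_{kk}}$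 for all $j\in J$, and (ii) $\tau_B(\boldsymbol w+U_J(2\rho))\cap(B-B_{\mathrm{abs}})\ne\emptyset$. Then $$\left|\int_{B-U_n(\rho)}H(\boldsymbol x)\,d\boldsymbol x\right|\le\int_{B_{\mathrm{abs}}}|H(\boldsymbol x)|\,d\boldsymbol x+\sum_{j=1}^n(n\|M\|_\infty)^jL(j).$$
   Context: $[n]=\{1,\dots,n\}$; $\boldsymbol e_1,\dots,\boldsymbol e_n$ is the standard basis of $\mathbb R^n$. $U_n(t)=\{\boldsymbol x\in\mathbb R^n:|x_j|\le t\text{ for }1\le j\le n\}$, and for $J\subseteq[n]$, $U_J(t)=\{\boldsymbol x\in U_n(t):x_j=0\text{ if }j\in J\}$. $\mathcal L$ is the lattice of points $k_1\boldsymbol f_1+\cdots+k_n\boldsymbol f_n$ with integers $k_j$, and $B=\{t_1\boldsymbol f_1+\cdots+t_n\boldsymbol f_n:t_j\in(-\frac12,\frac12]\}$. For $\boldsymbol x\in\mathbb R^n$, $\tau_B(\boldsymbol x)$ is the unique point of $B$ with $\boldsymbol x-\tau_B(\boldsymbol x)\in\mathcal L$; $\tau_B(S)=\{\tau_B(\boldsymbol x):\boldsymbol x\in S\}$. Set difference is written $B-S$, and $B+U_n(t)$ is the Minkowski sum. $\int_W$ is with respect to $(n-|J|)$-dimensional Lebesgue measure on the coordinates outside $J$. $\|M\|_\infty$ is the matrix norm induced by the $\ell_\infty$ vector norm. $\mathbf 1$ is the indicator function. $\Theta(1)$ means positive and bounded above and below by positive constants. "$\kappa$ is sufficiently small" means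 that $\kappa=\kappa(n)$ and $\limsup_n\kappa(n)$ is bounded by a sufficiently small constant depending only on the implicit constants in the bounds $O(n^{-1})$ and $\Theta(1)$ for the elements of $M$ and $M^{-1}$. *)

theory Defs
  imports "HOL-Analysis.Analysis"
begin

text \<open>
  The dimension \<open>n\<close> is quantified inside the theorem, so points of \<open>n\<close>-space are functions on
  \<open>{1..n}\<close>, in the extensional representation that \<open>PiM\<close> uses. More generally \<open>Rsp I\<close> is the
  space of real vectors with coordinates indexed by \<open>I\<close>. For \<open>I = {}\<close> it has one
  point, and \<open>leb {}\<close> gives that point mass 1.
\<close>

abbreviation Rsp :: "nat set \<Rightarrow> (nat \<Rightarrow> real) set" where
  "Rsp I \<equiv> I \<rightarrow>\<^sub>E UNIV"

definition leb :: "nat set \<Rightarrow> (nat \<Rightarrow> real) measure" where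
  "leb I = completion (PiM I (\<lambda>_. lborel))"

definition vadd :: "nat \<Rightarrow> (nat \<Rightarrow> real) \<Rightarrow> (nat \<Rightarrow> real) \<Rightarrow> nat \<Rightarrow> real" where
  "vadd n x y = (\<lambda>i\<in>{1..n}. x i + y i)"

definition vsub :: "nat \<Rightarrow> (nat \<Rightarrow> real) \<Rightarrow> (nat \<Rightarrow> real) \<Rightarrow> nat \<Rightarrow> real" where
  "vsub n x y = (\<lambda>i\<in>{1..n}. x i - y i)"

definition minkowski_sum ::
  "nat \<Rightarrow> (nat \<Rightarrow> real) set \<Rightarrow> (nat \<Rightarrow> real) set \<Rightarrow> (nat \<Rightarrow> real) set" where
  "minkowski_sum n S T = {vadd n x y | x y. x \<in> S \<and> y \<in> T}"

definition lincomb ::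
  "nat \<Rightarrow> nat set \<Rightarrow> (nat \<Rightarrow> real) \<Rightarrow> (nat \<Rightarrow> nat \<Rightarrow> real) \<Rightarrow> nat \<Rightarrow> real" where
  "lincomb n A c v = (\<lambda>i\<in>{1..n}. \<Sum>j\<in>A. c j * v j i)"

definition unit_vec :: "nat \<Rightarrow> nat \<Rightarrow> nat \<Rightarrow> real" where
  "unit_vec n j = (\<lambda>i\<in>{1..n}. if i = j then 1 else 0)"

definition span_of :: "nat \<Rightarrow> nat set \<Rightarrow> (nat \<Rightarrow> nat \<Rightarrow> real) \<Rightarrow> (nat \<Rightarrow> real) set" where
  "span_of n A v = {lincomb n A c v | c. True}"

definition is_basis :: "nat \<Rightarrow> (nat \<Rightarrow> nat \<Rightarrow> real) \<Rightarrow> bool" where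
  "is_basis n f \<longleftrightarrow> (\<forall>j\<in>{1..n}. f j \<in> Rsp {1..n}) \<and>
     (\<forall>x\<in>Rsp {1..n}. \<exists>!t. t \<in> Rsp {1..n} \<and> x = lincomb n {1..n} t f)"

text \<open>Matrices are functions of a row and a column index, both restricted to \<open>{1..n}\<close>.\<close>

definition col_matrix :: "(nat \<Rightarrow> nat \<Rightarrow> real) \<Rightarrow> nat \<Rightarrow> nat \<Rightarrow> real" where
  "col_matrix f = (\<lambda>j k. f k j)"

definition is_inverse_matrix ::
  "nat \<Rightarrow> (nat \<Rightarrow> nat \<Rightarrow> real) \<Rightarrow> (nat \<Rightarrow> nat \<Rightarrow> real) \<Rightarrow> bool" where
  "is_inverse_matrix n M N \<longleftrightarrow>
     (\<forall>i\<in>{1..n}. \<forall>j\<in>{1..n}.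
        (\<Sum>k=1..n. M i k * N k j) = (if i = j then 1 else 0) \<and>
        (\<Sum>k=1..n. N i k * M k j) = (if i = j then 1 else 0))"

definition linf_norm :: "nat \<Rightarrow> (nat \<Rightarrow> real) \<Rightarrow> real" where
  "linf_norm n x = Max ((\<lambda>i. \<bar>x i\<bar>) ` {1..n})"

definition matrix_linf_norm :: "nat \<Rightarrow> (nat \<Rightarrow> nat \<Rightarrow> real) \<Rightarrow> real" where
  "matrix_linf_norm n M =
     Sup {linf_norm n (\<lambda>i\<in>{1..n}. \<Sum>k=1..n. M i k * x k) | x.
            x \<in> Rsp {1..n} \<and> linf_norm n x \<le> 1}"

text \<open>
  The implicit constants are explicit here: \<open>C\<close> for the \<open>O(1/n)\<close> bound off the diagonal, and
  \<open>a\<close>, \<open>b\<close> for the \<open>\<Theta>(1)\<close> bounds on the diagonal.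
\<close>

definition entry_bounds ::
  "nat \<Rightarrow> real \<Rightarrow> real \<Rightarrow> real \<Rightarrow> (nat \<Rightarrow> nat \<Rightarrow> real) \<Rightarrow> bool" where
  "entry_bounds n C a b M \<longleftrightarrow>
     (\<forall>j\<in>{1..n}. \<forall>k\<in>{1..n}. j \<noteq> k \<longrightarrow> \<bar>M j k\<bar> \<le> C / real n) \<and>
     (\<forall>j\<in>{1..n}. a \<le> M j j \<and> M j j \<le> b)"

definition lattice_of :: "nat \<Rightarrow> (nat \<Rightarrow> nat \<Rightarrow> real) \<Rightarrow> (nat \<Rightarrow> real) set" where
  "lattice_of n f = {lincomb n {1..n} (\<lambda>j. real_of_int (k j)) f | k :: nat \<Rightarrow> int. True}"

definition basic_cell :: "nat \<Rightarrow> (nat \<Rightarrow> nat \<Rightarrow> real) \<Rightarrow> (nat \<Rightarrow> real) set" where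
  "basic_cell n f = {lincomb n {1..n} t f | t. \<forall>j\<in>{1..n}. - (1/2) < t j \<and> t j \<le> 1/2}"

definition cell_rep :: "nat \<Rightarrow> (nat \<Rightarrow> nat \<Rightarrow> real) \<Rightarrow> (nat \<Rightarrow> real) \<Rightarrow> nat \<Rightarrow> real" where
  "cell_rep n f x = (THE b. b \<in> basic_cell n f \<and> vsub n x b \<in> lattice_of n f)"

definition Ubox :: "nat \<Rightarrow> real \<Rightarrow> (nat \<Rightarrow> real) set" where
  "Ubox n t = {x \<in> Rsp {1..n}. \<forall>j\<in>{1..n}. \<bar>x j\<bar> \<le> t}"

definition Ubox_off :: "nat \<Rightarrow> nat set \<Rightarrow> real \<Rightarrow> (nat \<Rightarrow> real) set" where
  "Ubox_off n J t = {x \<in> Ubox n t. \<forall>j\<in>J. x j = 0}"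

text \<open>
  Cuboids are closed. Passing to the closure of a cuboid does not change an integral over it,
  nor its containing or being contained in a closed box. Degenerate sides are allowed, so a
  cuboid inside \<open>Ubox_off n J t\<close> has sides \<open>{0}\<close> in the directions of \<open>J\<close>.
\<close>

definition is_cuboid :: "nat \<Rightarrow> (nat \<Rightarrow> real) set \<Rightarrow> bool" where
  "is_cuboid n W \<longleftrightarrow> (\<exists>lo hi. W = PiE {1..n} (\<lambda>i. {lo i .. hi i}))"

text \<open>
  \<open>integral_off n J W F\<close> integrates \<open>F\<close> over \<open>W\<close>, a subset of the coordinate subspace where
  the coordinates in \<open>J\<close> vanish, with respect to Lebesgue measure on the remaining coordinates.
  For \<open>J = {1..n}\<close> and \<open>W = {0}\<close> it is the value of \<open>F\<close> at the origin.
\<close>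

definition embed_off :: "nat \<Rightarrow> nat set \<Rightarrow> (nat \<Rightarrow> real) \<Rightarrow> nat \<Rightarrow> real" where
  "embed_off n J z = (\<lambda>i\<in>{1..n}. if i \<in> J then 0 else z i)"

definition integral_off ::
  "nat \<Rightarrow> nat set \<Rightarrow> (nat \<Rightarrow> real) set \<Rightarrow> ((nat \<Rightarrow> real) \<Rightarrow> complex) \<Rightarrow> complex" where
  "integral_off n J W F =
     set_lebesgue_integral (leb ({1..n} - J))
       {z \<in> Rsp ({1..n} - J). embed_off n J z \<in> W} (\<lambda>z. F (embed_off n J z))"

definition affine_subspace :: "nat \<Rightarrow> (nat \<Rightarrow> real) set \<Rightarrow> bool" where
  "affine_subspace n S \<longleftrightarrow> S \<noteq> {} \<and> S \<subseteq> Rsp {1..n} \<and>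
     (\<forall>x\<in>S. \<forall>y\<in>S. \<forall>u::real. (\<lambda>i\<in>{1..n}. (1 - u) * x i + u * y i) \<in> S)"

text \<open>
  Measurability within an affine subspace \<open>S\<close> of dimension \<open>d\<close> is Lebesgue measurability in
  \<open>d\<close>-space after identifying \<open>S\<close> with it by an affine bijection; the choice of bijection
  does not matter, and every affine subspace has one.
\<close>

definition measurable_within ::
  "nat \<Rightarrow> (nat \<Rightarrow> real) set \<Rightarrow> (nat \<Rightarrow> real) set \<Rightarrow> bool" where
  "measurable_within n S A \<longleftrightarrow>
     (\<forall>d p v. bij_betw (\<lambda>t. vadd n p (lincomb n {1..d} t v)) (Rsp {1..d}) S \<longrightarrow>
        {t \<in> Rsp {1..d}. vadd n p (lincomb n {1..d} t v) \<in> A} \<in> sets (leb {1..d}))"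

end

theory Submission imports Defs begin

text \<open>
  Every lattice coset with few large coordinates gets a representative other than the one in
  \<open>B\<close>: the minimiser of \<open>Phi x = (\<Sum>i. max 0 (\<bar>x i\<bar> - \<theta>))\<close>, with a lexicographic
  tie-break. Because the columns of the matrix are nearly diagonal, only lattice shifts along
  coordinates with \<open>\<bar>x i\<bar> > 2\<theta>\<close> compete, there are \<open>O(\<zeta>\<rho>n)\<close> of these, and such a shift moves
  the other coordinates by much less than \<open>\<rho>\<close>. Hence minimality does not depend on the
  coordinates of absolute value at most \<open>\<rho>\<close>: fixing \<open>J = {i. \<bar>x i\<bar> > \<rho>}\<close> and the coordinates
  \<open>w\<close> in \<open>J\<close>, the representatives form the full cuboid \<open>w + U\<^sub>J(\<rho>)\<close>. Each such cuboid either
  meets \<open>B - Babs\<close> modulo the lattice, and then its integral is at most \<open>L(card J)\<close>, or lies in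
  \<open>Babs\<close>. Integrating over \<open>w\<close>, whose \<open>j\<close>-th coordinate ranges over a set of measure at most
  \<open>m\<^sub>j\<^sub>j\<close>, and summing over \<open>J\<close> gives the bound; \<open>J = {}\<close> is the excluded box \<open>U\<^sub>n(\<rho>)\<close>.
\<close>

text \<open>Slicing \<open>B\<close> directly fails: its faces are oblique, so fixing the
  coordinates in J and bounding the others cuts out polytopes that need not be cuboids, while the
  hypothesis speaks of cuboids only. A Euclidean (Voronoi) choice of representatives fails too,
  since there every coordinate influences the comparison. In \<open>Phi\<close> each coordinate has
  a dead zone of half-width \<theta>, a constant depending only on C, a, b and at least 4\<rho>; the
  gap between \<rho> and \<theta> lets a lattice shift perturb a coordinate below \<rho> without
  \<open>Phi\<close> noticing. Outside the dead zone the slope is 1, so a bound on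
  \<open>Phi\<close> bounds the l1 norm of the lattice coefficients between two points of a coset,
  and with off-diagonal entries of size C/n this norm controls how far the other coordinates move.
  The price is that \<open>Phi\<close> does not see coordinates between \<rho> and \<theta>, so the
  sum of the coordinates above \<rho> (\<open>big_sum\<close>) is controlled separately. A coset
  with too many large coordinates need not have a representative of this kind; its point in
  \<open>B\<close> is charged to \<open>Babs\<close>.\<close>

section \<open>Completed product measures\<close>

declare One_nat_def [simp del]

section \<open>Measurability modulo null sets\<close>

lemma borel_measurable_completion_cong_AE:
  assumes g: "g \<in> borel_measurable M" and eq: "AE x in M. f x = g x"
  shows "f \<in> borel_measurable (completion M)"
proof (rule measurableI)
  fix A :: "'b set" assume A: "A \<in> sets borel"
  show "f -` A \<inter> space (completion M) \<in> sets (completion M)"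
  proof (rule completion.in_sets_AE)
    show "AE x in completion M. x \<in> g -` A \<inter> space M \<longleftrightarrow> x \<in> f -` A \<inter> space (completion M)"
      using AE_completion[OF eq] by eventually_elim auto
    show "g -` A \<inter> space M \<in> sets (completion M)"
      using measurable_sets[OF g A] by auto
  qed auto
qed auto

lemma completion_ex_borel_measurable_complex:
  fixes f :: "'a \<Rightarrow> complex"
  assumes f: "f \<in> borel_measurable (completion M)"
  shows "\<exists>g\<in>borel_measurable M. AE x in M. f x = g x"
proof -
  have "(\<lambda>x. Re (f x)) \<in> borel_measurable (completion M)"
    "(\<lambda>x. Im (f x)) \<in> borel_measurable (completion M)"
    using f by (auto intro: borel_measurable_Re borel_measurable_Im)
  then obtain u v where u: "u \<in> borel_measurable M" "AE x in M. Re (f x) = u x"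
    and v: "v \<in> borel_measurable M" "AE x in M. Im (f x) = v x"
    by (blast dest: completion_ex_borel_measurable_real)
  show ?thesis
  proof
    show "(\<lambda>x. Complex (u x) (v x)) \<in> borel_measurable M"
      using u v by (auto simp: borel_measurable_complex_iff)
    show "AE x in M. f x = Complex (u x) (v x)"
      using u(2) v(2) by eventually_elim (simp add: complex_eq_iff)
  qed
qed

abbreviation Lb :: "nat set \<Rightarrow> (nat \<Rightarrow> real) measure" where
  "Lb I \<equiv> PiM I (\<lambda>_. lborel)"

lemma space_Lb: "space (Lb I) = Rsp I"
  by (simp add: space_PiM)

lemma space_leb [simp]: "space (leb I) = Rsp I"
  by (simp add: leb_def space_PiM)

lemma sets_leb_I: "A \<in> sets (Lb I) \<Longrightarrow> A \<in> sets (leb I)"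
  by (simp add: leb_def)

interpretation lborel_family: product_sigma_finite "\<lambda>_::nat. lborel::real measure"
  by standard

section \<open>Translation invariance of product Lebesgue measure and of its completion\<close>

lemma Lb_translate_measurable:
  "(\<lambda>x. \<lambda>i\<in>I. x i + c i) \<in> measurable (Lb I) (Lb I)"
  by (rule measurable_restrict) (auto intro!: borel_measurable_add measurable_component_singleton)

lemma distr_Lb_translate:
  assumes "finite I"
  shows "distr (Lb I) (Lb I) (\<lambda>x. \<lambda>i\<in>I. x i + c i) = Lb I"
proof (rule lborel_family.PiM_eqI[OF assms])
  fix A :: "nat \<Rightarrow> real set" assume A: "\<And>i. i \<in> I \<Longrightarrow> A i \<in> sets lborel"
  have *: "(\<lambda>x. \<lambda>i\<in>I. x i + c i) -` Pi\<^sub>E I A \<inter> space (Lb I) = Pi\<^sub>E I (\<lambda>i. (+) (c i) -` A i)"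
    by (auto simp: space_PiM PiE_iff add.commute)
  have m: "(+) (c i) -` A i \<in> sets lborel" if "i \<in> I" for i
    using measurable_sets[of "(+) (c i)" borel borel "A i"] A[OF that] by auto
  have "emeasure (distr (Lb I) (Lb I) (\<lambda>x. \<lambda>i\<in>I. x i + c i)) (Pi\<^sub>E I A)
      = emeasure (Lb I) (Pi\<^sub>E I (\<lambda>i. (+) (c i) -` A i))"
    using A assms by (subst emeasure_distr[OF Lb_translate_measurable]) (auto simp: * intro!: sets_PiM_I_finite)
  also have "\<dots> = (\<Prod>i\<in>I. emeasure lborel ((+) (c i) -` A i))"
    using m assms by (subst lborel_family.emeasure_PiM) auto
  also have "\<dots> = (\<Prod>i\<in>I. emeasure lborel (A i))"
  proof (rule prod.cong[OF refl])
    fix i assume i: "i \<in> I"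
    have "emeasure lborel (A i) = emeasure (distr lborel borel ((+) (c i))) (A i)"
      by (simp add: lborel_distr_plus)
    also have "\<dots> = emeasure lborel ((+) (c i) -` A i)"
      using A[OF i] by (subst emeasure_distr) auto
    finally show "emeasure lborel ((+) (c i) -` A i) = emeasure lborel (A i)" ..
  qed
  finally show "emeasure (distr (Lb I) (Lb I) (\<lambda>x. \<lambda>i\<in>I. x i + c i)) (Pi\<^sub>E I A)
      = (\<Prod>i\<in>I. emeasure lborel (A i))" .
qed simp

text \<open>Measurability into a completion needs preimages of null sets to be null; here this
  follows from invariance of the Borel product measure.\<close>

lemma leb_translate:
  assumes "finite I"
  shows leb_translate_measurable: "(\<lambda>x. \<lambda>i\<in>I. x i + c i) \<in> measurable (leb I) (leb I)"
    and distr_leb_translate: "distr (leb I) (leb I) (\<lambda>x. \<lambda>i\<in>I. x i + c i) = leb I"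
proof -
  let ?T = "\<lambda>x::nat\<Rightarrow>real. \<lambda>i\<in>I. x i + c i"
  have m: "?T \<in> measurable (leb I) (Lb I)"
    unfolding leb_def by (rule measurable_completion[OF Lb_translate_measurable])
  have d: "distr (leb I) (Lb I) ?T = Lb I"
    unfolding leb_def by (subst distr_completion) (auto simp: Lb_translate_measurable distr_Lb_translate[OF assms])
  show "?T \<in> measurable (leb I) (leb I)"
    using completion.measurable_completion2[of ?T "Lb I" "Lb I"] m d unfolding leb_def by simp
  show "distr (leb I) (leb I) ?T = leb I"
    using completion.completion_distr_eq[of ?T "Lb I" "Lb I"] m d unfolding leb_def by simp
qed

text \<open>Fubini for the completion of a product: the slices of a Lebesgue measurable F are
  measurable for almost every w only, so F is replaced by a Borel version G whose iterated integral
  makes sense everywhere. The existence of G is a hypothesis because F is complex in one application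
  and real in the other, and G comes from different lemmas.\<close>

lemma leb_ex_borel:
  fixes F :: "(nat \<Rightarrow> real) \<Rightarrow> 'b::{banach, second_countable_topology}"
  assumes F: "integrable (leb (J \<union> K)) F" and JK: "J \<inter> K = {}" "finite J" "finite K"
    and ex: "\<exists>G\<in>borel_measurable (Lb (J \<union> K)). AE x in Lb (J \<union> K). F x = G x"
  obtains G where
    "integrable (Lb J) (\<lambda>w. \<integral>y. G (merge J K (w, y)) \<partial>Lb K)"
    "integral\<^sup>L (leb (J \<union> K)) F = (\<integral>w. (\<integral>y. G (merge J K (w, y)) \<partial>Lb K) \<partial>Lb J)"
    "AE w in Lb J. integrable (leb K) (\<lambda>y. F (merge J K (w, y))) \<and>
        (\<integral>y. F (merge J K (w, y)) \<partial>leb K) = (\<integral>y. G (merge J K (w, y)) \<partial>Lb K)"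
proof -
  interpret J: finite_product_sigma_finite "\<lambda>_. lborel" J by standard fact
  interpret K: finite_product_sigma_finite "\<lambda>_. lborel" K by standard fact
  interpret P: pair_sigma_finite "Lb J" "Lb K" ..
  obtain G where Gm: "G \<in> borel_measurable (Lb (J \<union> K))" and FG: "AE x in Lb (J \<union> K). F x = G x"
    using ex by auto
  have Gi': "integrable (leb (J \<union> K)) G"
    using F Gm FG unfolding leb_def
    by (auto intro: integrable_cong_AE_imp AE_completion measurable_completion)
  have FG': "AE x in leb (J \<union> K). F x = G x"
    unfolding leb_def by (rule AE_completion[OF FG])
  from Gi' have Gi: "integrable (Lb (J \<union> K)) G"
    unfolding leb_def using integrable_completion[OF Gm] by simp
  have D: "distr (Lb J \<Otimes>\<^sub>M Lb K) (Lb (J \<union> K)) (merge J K) = Lb (J \<union> K)"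
    by (rule lborel_family.distr_merge[OF JK])
  have "AE x in distr (Lb J \<Otimes>\<^sub>M Lb K) (Lb (J \<union> K)) (merge J K). F x = G x"
    unfolding D by (rule FG)
  then have "AE x in Lb J \<Otimes>\<^sub>M Lb K. F (merge J K x) = G (merge J K x)"
    by (rule AE_distrD[OF measurable_merge])
  then have AE1: "AE w in Lb J. AE y in Lb K. F (merge J K (w, y)) = G (merge J K (w, y))"
    by (rule P.AE_pair)
  have Gp: "integrable (Lb J \<Otimes>\<^sub>M Lb K) (\<lambda>x. G (merge J K x))"
    by (rule integrable_distr[OF measurable_merge]) (simp add: D Gi)
  have AE2: "AE w in Lb J. integrable (Lb K) (\<lambda>y. G (merge J K (w, y)))"
    by (rule P.AE_integrable_fst'[OF Gp])
  show ?thesis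
  proof
    show "integrable (Lb J) (\<lambda>w. \<integral>y. G (merge J K (w, y)) \<partial>Lb K)"
      by (rule P.integrable_fst'[OF Gp])
    have "integral\<^sup>L (leb (J \<union> K)) F = integral\<^sup>L (leb (J \<union> K)) G"
      using F Gi' FG' by (intro integral_cong_AE) auto
    also have "\<dots> = integral\<^sup>L (Lb (J \<union> K)) G"
      unfolding leb_def by (rule integral_completion[OF Gm])
    also have "\<dots> = (\<integral>w. (\<integral>y. G (merge J K (w, y)) \<partial>Lb K) \<partial>Lb J)"
      by (rule lborel_family.product_integral_fold[OF JK Gi])
    finally show "integral\<^sup>L (leb (J \<union> K)) F = (\<integral>w. (\<integral>y. G (merge J K (w, y)) \<partial>Lb K) \<partial>Lb J)" .
    show "AE w in Lb J. integrable (leb K) (\<lambda>y. F (merge J K (w, y))) \<and>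
        (\<integral>y. F (merge J K (w, y)) \<partial>leb K) = (\<integral>y. G (merge J K (w, y)) \<partial>Lb K)"
      using AE1 AE2
    proof eventually_elim
      case (elim w)
      have m: "(\<lambda>y. G (merge J K (w, y))) \<in> borel_measurable (Lb K)"
        using elim(2) by auto
      have Fm: "(\<lambda>y. F (merge J K (w, y))) \<in> borel_measurable (leb K)"
        unfolding leb_def by (rule borel_measurable_completion_cong_AE[OF m elim(1)])
      have ae: "AE y in leb K. F (merge J K (w, y)) = G (merge J K (w, y))"
        unfolding leb_def by (rule AE_completion[OF elim(1)])
      have mG: "(\<lambda>y. G (merge J K (w, y))) \<in> borel_measurable (leb K)"
        unfolding leb_def by (rule measurable_completion[OF m])
      have "integrable (leb K) (\<lambda>y. G (merge J K (w, y)))"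
        unfolding leb_def using integrable_completion[OF m] elim(2) by simp
      then have 1: "integrable (leb K) (\<lambda>y. F (merge J K (w, y)))"
        using integrable_cong_AE[OF Fm mG ae] by simp
      have "(\<integral>y. F (merge J K (w, y)) \<partial>leb K) = (\<integral>y. G (merge J K (w, y)) \<partial>leb K)"
        by (rule integral_cong_AE[OF Fm mG ae])
      also have "\<dots> = (\<integral>y. G (merge J K (w, y)) \<partial>Lb K)"
        unfolding leb_def by (rule integral_completion[OF m])
      finally show ?case using 1 by simp
    qed
  qed
qed

text \<open>The slice bound is required only where both slices are integrable, which is almost
  everywhere. At the remaining w the integral of Q would be the default value 0 and the bound could
  fail.\<close>

lemma norm_integral_le_slices:
  fixes F :: "(nat \<Rightarrow> real) \<Rightarrow> complex" and Q :: "(nat \<Rightarrow> real) \<Rightarrow> real"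
  assumes F: "integrable (leb (J \<union> K)) F" and Q: "integrable (leb (J \<union> K)) Q"
    and JK: "J \<inter> K = {}" "finite J" "finite K"
    and A: "A \<in> sets (Lb J)" "emeasure (Lb J) A < \<infinity>" 
    and bound: "\<And>w. w \<in> Rsp J \<Longrightarrow> integrable (leb K) (\<lambda>y. F (merge J K (w, y))) \<Longrightarrow>
        integrable (leb K) (\<lambda>y. Q (merge J K (w, y))) \<Longrightarrow>
        norm (\<integral>y. F (merge J K (w, y)) \<partial>leb K)
          \<le> c * indicator A w + (\<integral>y. Q (merge J K (w, y)) \<partial>leb K)"
  shows "norm (integral\<^sup>L (leb (J \<union> K)) F) \<le> c * measure (Lb J) A + integral\<^sup>L (leb (J \<union> K)) Q"
proof -
  have "F \<in> borel_measurable (completion (Lb (J \<union> K)))" "Q \<in> borel_measurable (completion (Lb (J \<union> K)))"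
    using F Q by (auto simp: leb_def)
  note ex = completion_ex_borel_measurable_complex[OF this(1)]
    completion_ex_borel_measurable_real[OF this(2)]
  obtain G where G:
    "integrable (Lb J) (\<lambda>w. \<integral>y. G (merge J K (w, y)) \<partial>Lb K)"
    "integral\<^sup>L (leb (J \<union> K)) F = (\<integral>w. (\<integral>y. G (merge J K (w, y)) \<partial>Lb K) \<partial>Lb J)"
    "AE w in Lb J. integrable (leb K) (\<lambda>y. F (merge J K (w, y))) \<and>
        (\<integral>y. F (merge J K (w, y)) \<partial>leb K) = (\<integral>y. G (merge J K (w, y)) \<partial>Lb K)"
    by (rule leb_ex_borel[OF F JK ex(1)])
  obtain R where R:
    "integrable (Lb J) (\<lambda>w. \<integral>y. R (merge J K (w, y)) \<partial>Lb K)"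
    "integral\<^sup>L (leb (J \<union> K)) Q = (\<integral>w. (\<integral>y. R (merge J K (w, y)) \<partial>Lb K) \<partial>Lb J)"
    "AE w in Lb J. integrable (leb K) (\<lambda>y. Q (merge J K (w, y))) \<and>
        (\<integral>y. Q (merge J K (w, y)) \<partial>leb K) = (\<integral>y. R (merge J K (w, y)) \<partial>Lb K)"
    by (rule leb_ex_borel[OF Q JK ex(2)])
  have iA: "integrable (Lb J) (\<lambda>w. c * indicator A w)"
    using A by auto
  have "norm (integral\<^sup>L (leb (J \<union> K)) F) \<le> (\<integral>w. norm (\<integral>y. G (merge J K (w, y)) \<partial>Lb K) \<partial>Lb J)"
    unfolding G(2) by (rule integral_norm_bound)
  also have "\<dots> \<le> (\<integral>w. c * indicator A w + (\<integral>y. R (merge J K (w, y)) \<partial>Lb K) \<partial>Lb J)"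
  proof (rule integral_mono_AE)
    show "AE w in Lb J. norm (\<integral>y. G (merge J K (w, y)) \<partial>Lb K)
        \<le> c * indicator A w + (\<integral>y. R (merge J K (w, y)) \<partial>Lb K)"
      using AE_space G(3) R(3)
    proof eventually_elim
      case (elim w)
      then show ?case using bound[of w] by (auto simp: space_PiM)
    qed
  qed (use G(1) R(1) iA in auto)
  also have "\<dots> = c * measure (Lb J) A + integral\<^sup>L (leb (J \<union> K)) Q"
    using iA R(1) A by (subst Bochner_Integration.integral_add) (auto simp: R(2))
  finally show ?thesis .
qed

section \<open>Lattice cosets and their representatives\<close>

(* These rules make auto unfold membership in Rsp, often without terminating. *)
declare PiE_I [rule del] PiE_E [rule del] PiE [rule del]

locale lattice_basis =
  fixes n :: nat and f N :: "nat \<Rightarrow> nat \<Rightarrow> real"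
  assumes n_ge_1: "n \<ge> 1"
    and inverse: "is_inverse_matrix n (col_matrix f) N"
begin

section \<open>Coordinates in the lattice basis and reduction to the cell\<close>

definition lp :: "(nat \<Rightarrow> int) \<Rightarrow> nat \<Rightarrow> real" where
  "lp k = lincomb n {1..n} (\<lambda>j. real_of_int (k j)) f"

definition cf :: "(nat \<Rightarrow> real) \<Rightarrow> nat \<Rightarrow> real" where
  "cf x j = (\<Sum>k=1..n. N j k * x k)"

text \<open>The cell is open at -1/2 and closed at 1/2, so a coordinate c is rounded to the integer
  k with c - 1/2 \<le> k < c + 1/2, a ceiling. Restriction to \<open>{1..n}\<close> makes equal
  lattice points have equal index functions.\<close>

definition idx :: "(nat \<Rightarrow> real) \<Rightarrow> nat \<Rightarrow> int" where
  "idx x = (\<lambda>j\<in>{1..n}. \<lceil>cf x j - 1/2\<rceil>)"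

lemma lp_apply: "i \<in> {1..n} \<Longrightarrow> lp k i = (\<Sum>j=1..n. real_of_int (k j) * f j i)"
  by (simp add: lp_def lincomb_def)

lemma lp_extensional [simp]: "lp k \<in> Rsp {1..n}"
  by (simp add: lp_def lincomb_def)

lemma vsub_extensional [simp]: "vsub n x y \<in> Rsp {1..n}"
  by (simp add: vsub_def)

lemma vadd_extensional [simp]: "vadd n x y \<in> Rsp {1..n}"
  by (simp add: vadd_def)

lemma lp_cong: "(\<And>j. j \<in> {1..n} \<Longrightarrow> k j = l j) \<Longrightarrow> lp k = lp l"
  unfolding lp_def lincomb_def by (intro restrict_ext sum.cong) auto

lemma lp_diff: "lp (\<lambda>j. k j - l j) = vsub n (lp k) (lp l)"
  by (auto simp: lp_def lincomb_def vsub_def sum_subtractf left_diff_distrib)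

lemma lp_add: "lp (\<lambda>j. k j + l j) = vadd n (lp k) (lp l)"
  by (auto simp: lp_def lincomb_def vadd_def sum.distrib distrib_right)

lemma Rsp_eqI: "x \<in> Rsp {1..n} \<Longrightarrow> y \<in> Rsp {1..n} \<Longrightarrow> (\<And>i. i \<in> {1..n} \<Longrightarrow> x i = y i) \<Longrightarrow> x = y"
  by (rule PiE_ext) auto

lemma cf_lincomb:
  assumes j: "j \<in> {1..n}"
  shows "cf (lincomb n {1..n} t f) j = t j"
proof -
  have "cf (lincomb n {1..n} t f) j = (\<Sum>k=1..n. \<Sum>l=1..n. N j k * (t l * f l k))"
    unfolding cf_def by (intro sum.cong) (auto simp: lincomb_def sum_distrib_left)
  also have "\<dots> = (\<Sum>l=1..n. t l * (\<Sum>k=1..n. N j k * f l k))"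
    by (subst sum.swap) (auto simp: sum_distrib_left intro!: sum.cong)
  also have "\<dots> = (\<Sum>l=1..n. t l * (if j = l then 1 else 0))"
    using inverse j by (intro sum.cong) (auto simp: is_inverse_matrix_def col_matrix_def)
  also have "\<dots> = t j" using j by (simp add: if_distrib cong: if_cong)
  finally show ?thesis .
qed

lemma lincomb_cf:
  assumes x: "x \<in> Rsp {1..n}"
  shows "lincomb n {1..n} (cf x) f = x"
proof (rule Rsp_eqI)
  fix i assume i: "i \<in> {1..n}"
  have "lincomb n {1..n} (cf x) f i = (\<Sum>j=1..n. \<Sum>k=1..n. N j k * x k * f j i)"
    using i by (auto simp: lincomb_def cf_def sum_distrib_right)
  also have "\<dots> = (\<Sum>k=1..n. x k * (\<Sum>j=1..n. f j i * N j k))"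
    by (subst sum.swap) (auto simp: sum_distrib_left mult_ac intro!: sum.cong)
  also have "\<dots> = (\<Sum>k=1..n. x k * (if i = k then 1 else 0))"
    using inverse i by (intro sum.cong) (auto simp: is_inverse_matrix_def col_matrix_def)
  also have "\<dots> = x i" using i by (simp add: if_distrib cong: if_cong)
  finally show "lincomb n {1..n} (cf x) f i = x i" .
qed (use x in \<open>auto simp: lincomb_def\<close>)

lemma cf_lp: "j \<in> {1..n} \<Longrightarrow> cf (lp k) j = real_of_int (k j)"
  unfolding lp_def by (rule cf_lincomb)

lemma cf_vsub: "cf (vsub n x y) j = cf x j - cf y j"
  unfolding cf_def vsub_def by (simp add: algebra_simps sum_subtractf)

lemma basic_cell_iff:
  "x \<in> basic_cell n f \<longleftrightarrow> x \<in> Rsp {1..n} \<and> (\<forall>j\<in>{1..n}. - (1/2) < cf x j \<and> cf x j \<le> 1/2)"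
proof
  assume "x \<in> basic_cell n f"
  then show "x \<in> Rsp {1..n} \<and> (\<forall>j\<in>{1..n}. - (1/2) < cf x j \<and> cf x j \<le> 1/2)"
    unfolding basic_cell_def by (clarsimp simp: cf_lincomb) (simp add: lincomb_def)
next
  assume "x \<in> Rsp {1..n} \<and> (\<forall>j\<in>{1..n}. - (1/2) < cf x j \<and> cf x j \<le> 1/2)"
  then show "x \<in> basic_cell n f"
    unfolding basic_cell_def by (intro CollectI exI[of _ "cf x"]) (auto simp: lincomb_cf)
qed

lemma basic_cell_Rsp: "x \<in> basic_cell n f \<Longrightarrow> x \<in> Rsp {1..n}"
  by (simp add: basic_cell_iff)

lemma lattice_of_iff: "x \<in> lattice_of n f \<longleftrightarrow> (\<exists>k. x = lp k)"
  by (auto simp: lattice_of_def lp_def)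

lemma idx_unique:
  assumes "vsub n x (lp k) \<in> basic_cell n f" "j \<in> {1..n}"
  shows "k j = idx x j"
proof -
  have "- (1/2) < cf x j - k j" "cf x j - k j \<le> 1/2"
    using assms by (auto simp: basic_cell_iff cf_vsub cf_lp)
  then have "\<lceil>cf x j - 1/2\<rceil> = k j" by linarith
  then show ?thesis using assms by (simp add: idx_def)
qed

lemma idx_in_cell: "vsub n x (lp (idx x)) \<in> basic_cell n f"
proof -
  have "- (1/2) < cf x j - \<lceil>cf x j - 1/2\<rceil> \<and> cf x j - \<lceil>cf x j - 1/2\<rceil> \<le> 1/2" for j
    by linarith
  then show ?thesis
    by (auto simp: basic_cell_iff cf_vsub cf_lp idx_def)
qed

lemma vsub_vsub: "vsub n (vsub n x y) z = vsub n x (vadd n y z)"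
  by (auto simp: vsub_def vadd_def)

lemma vsub_cancel: "y \<in> Rsp {1..n} \<Longrightarrow> vsub n x (vsub n x y) = y"
  by (rule Rsp_eqI) (simp_all add: vsub_def)

lemma cell_rep_eq:
  assumes x: "x \<in> Rsp {1..n}"
  shows "cell_rep n f x = vsub n x (lp (idx x))"
  unfolding cell_rep_def
proof (rule the_equality)
  have "vsub n x (vsub n x (lp (idx x))) = lp (idx x)"
    using x by (simp add: vsub_cancel)
  then show "vsub n x (lp (idx x)) \<in> basic_cell n f \<and> vsub n x (vsub n x (lp (idx x))) \<in> lattice_of n f"
    using idx_in_cell[of x] by (auto simp: lattice_of_iff)
next
  fix b assume b: "b \<in> basic_cell n f \<and> vsub n x b \<in> lattice_of n f"
  then obtain k where k: "vsub n x b = lp k" by (auto simp: lattice_of_iff)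
  have bk: "b = vsub n x (lp k)"
    using vsub_cancel[of b x] b by (simp add: k[symmetric] basic_cell_Rsp)
  have "lp k = lp (idx x)"
    by (rule lp_cong) (use idx_unique[of x k] b bk in auto)
  with bk show "b = vsub n x (lp (idx x))" by simp
qed

lemma cell_rep_in_cell: "x \<in> Rsp {1..n} \<Longrightarrow> cell_rep n f x \<in> basic_cell n f"
  by (simp add: cell_rep_eq idx_in_cell)

lemma cell_rep_eqI:
  assumes "x \<in> Rsp {1..n}" "vsub n x (lp k) \<in> basic_cell n f"
  shows "cell_rep n f x = vsub n x (lp k)"
proof -
  have "lp k = lp (idx x)"
    by (rule lp_cong) (use idx_unique[of x k] assms in auto)
  then show ?thesis using assms by (simp add: cell_rep_eq)
qed

lemma cell_rep_vsub_lp: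
  assumes x: "x \<in> Rsp {1..n}"
  shows "cell_rep n f (vsub n x (lp k)) = cell_rep n f x"
proof -
  have eq: "vsub n (vsub n x (lp k)) (lp (\<lambda>j. idx x j - k j)) = vsub n x (lp (idx x))"
    by (simp add: lp_diff) (auto simp: vsub_def)
  have "vsub n (vsub n x (lp k)) (lp (\<lambda>j. idx x j - k j)) \<in> basic_cell n f"
    unfolding eq by (rule idx_in_cell)
  then have "cell_rep n f (vsub n x (lp k)) = vsub n (vsub n x (lp k)) (lp (\<lambda>j. idx x j - k j))"
    by (rule cell_rep_eqI[rotated]) simp
  then show ?thesis using x by (simp only: eq cell_rep_eq)
qed

lemma cell_rep_cell:
  assumes "x \<in> basic_cell n f"
  shows "cell_rep n f x = x"
proof -
  have x: "x \<in> Rsp {1..n}" using assms by (simp add: basic_cell_iff)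
  have "vsub n x (lp (\<lambda>_. 0)) = x"
    using x by (intro Rsp_eqI) (auto simp: vsub_def lp_def lincomb_def)
  then show ?thesis using cell_rep_eqI[of x "\<lambda>_. 0"] assms x by simp
qed

lemma vsub_lp: "vsub n x (lp k) = vadd n x (lp (\<lambda>j. - k j))"
  by (rule Rsp_eqI) (simp_all add: vadd_def vsub_def lp_apply sum_negf)

lemma cell_rep_vadd_lp:
  assumes x: "x \<in> Rsp {1..n}"
  shows "cell_rep n f (vadd n x (lp k)) = cell_rep n f x"
  using cell_rep_vsub_lp[OF x, of "\<lambda>j. - k j"] by (simp add: vsub_lp)

lemma cell_rep_eqE:
  assumes x: "x \<in> Rsp {1..n}" and y: "y \<in> Rsp {1..n}" and eq: "cell_rep n f x = cell_rep n f y"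
  obtains k where "k \<in> {1..n} \<rightarrow>\<^sub>E UNIV" "y = vsub n x (lp k)"
proof
  let ?k = "\<lambda>j\<in>{1..n}. idx x j - idx y j"
  show "?k \<in> {1..n} \<rightarrow>\<^sub>E UNIV" by simp
  have *: "lp ?k = vsub n (lp (idx x)) (lp (idx y))"
    unfolding lp_diff[symmetric] by (rule lp_cong) simp
  have "vsub n x (lp (idx x)) = vsub n y (lp (idx y))"
    using eq x y by (simp add: cell_rep_eq)
  then have "x i - lp (idx x) i = y i - lp (idx y) i" if "i \<in> {1..n}" for i
    using that by (auto simp: vsub_def dest: fun_cong[of _ _ i])
  then show "y = vsub n x (lp ?k)"
    unfolding * by (intro Rsp_eqI[OF y]) (auto simp: vsub_def algebra_simps)
qed

section \<open>Moving integrals of periodic functions between transversals\<close>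

lemma cf_measurable [measurable]: "(\<lambda>x. cf x j) \<in> borel_measurable (Lb {1..n})"
  unfolding cf_def by (intro borel_measurable_sum borel_measurable_times) auto

lemma basic_cell_sets: "basic_cell n f \<in> sets (Lb {1..n})"
proof -
  have "basic_cell n f = {x \<in> space (Lb {1..n}). \<forall>j\<in>{1..n}. - (1/2) < cf x j \<and> cf x j \<le> 1/2}"
    unfolding space_Lb using basic_cell_iff by blast
  also have "\<dots> \<in> sets (Lb {1..n})" by measurable
  finally show ?thesis .
qed

lemma vadd_measurable: "(\<lambda>x. vadd n x c) \<in> measurable (Lb {1..n}) (Lb {1..n})"
  unfolding vadd_def by (rule Lb_translate_measurable)

(* Cut D along the lattice translates of the basic cell and move the pieces back. *)
lemma integral_transversal:
  fixes g :: "(nat \<Rightarrow> real) \<Rightarrow> 'b::{banach, second_countable_topology}"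
  assumes periodic: "\<And>x. x \<in> Rsp {1..n} \<Longrightarrow> g (cell_rep n f x) = g x"
    and int: "set_integrable (leb {1..n}) (basic_cell n f) g"
    and D: "D \<in> sets (Lb {1..n})"
    and idx: "finite \<K>" "idx ` D \<subseteq> \<K>"
    and inj: "\<And>x y. x \<in> D \<Longrightarrow> y \<in> D \<Longrightarrow> cell_rep n f x = cell_rep n f y \<Longrightarrow> x = y"
  shows cell_rep_image_sets: "cell_rep n f ` D \<in> sets (Lb {1..n})" (is ?S)
    and set_integrable_transversal: "set_integrable (leb {1..n}) D g" (is ?I)
    and set_integral_transversal: "set_lebesgue_integral (leb {1..n}) D g
      = set_lebesgue_integral (leb {1..n}) (cell_rep n f ` D) g" (is ?E)
proof -
  let ?L = "leb {1..n}" and ?B = "basic_cell n f"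
  have DR: "D \<subseteq> Rsp {1..n}"
    using sets.sets_into_space[OF D] by (simp add: space_PiM)
  define T where "T k = {x \<in> ?B. vadd n x (lp k) \<in> D}" for k
  define P where "P k = {x \<in> D. vsub n x (lp k) \<in> ?B}" for k
  have vv: "vsub n (vadd n x y) y = x" "vadd n (vsub n x y) y = x" if "x \<in> Rsp {1..n}" for x y
    by (rule Rsp_eqI, simp, rule that, simp add: vadd_def vsub_def)+
  have BR: "?B \<subseteq> Rsp {1..n}" using basic_cell_Rsp by blast
  have T_sets: "T k \<in> sets (Lb {1..n})" for k
  proof -
    have "T k = ?B \<inter> ((\<lambda>x. vadd n x (lp k)) -` D \<inter> space (Lb {1..n}))"
      using BR by (auto simp: T_def space_PiM)
    then show ?thesis
      using basic_cell_sets measurable_sets[OF vadd_measurable D] by auto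
  qed
  \<comment> \<open>Only extensional indices are kept: two functions agreeing on
    \<open>{1..n}\<close> give the same lattice point, and the same piece would be counted
    twice.\<close>
  define K where "K = {k \<in> \<K>. k \<in> {1..n} \<rightarrow>\<^sub>E UNIV}"
  have finK: "finite K" using idx by (auto simp: K_def)
  have idxK: "idx x \<in> K" if "x \<in> D" for x
    using that idx by (auto simp: K_def idx_def)
  have P_iff: "x \<in> P k \<longleftrightarrow> x \<in> D \<and> k = idx x" if "k \<in> K" for x k
  proof
    assume x: "x \<in> P k"
    have "k = idx x"
    proof (rule PiE_ext)
      show "k \<in> {1..n} \<rightarrow>\<^sub>E UNIV" using that by (simp add: K_def)
      show "idx x \<in> {1..n} \<rightarrow>\<^sub>E UNIV" by (simp add: idx_def)
    qed (use x in \<open>auto simp: P_def intro: idx_unique\<close>)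
    with x show "x \<in> D \<and> k = idx x" by (simp add: P_def)
  qed (auto simp: P_def idx_in_cell)
  have image: "cell_rep n f ` D = (\<Union>k\<in>K. T k)"
  proof (intro equalityI subsetI)
    fix b assume "b \<in> cell_rep n f ` D"
    then obtain x where x: "x \<in> D" "b = vsub n x (lp (idx x))"
      using DR by (auto simp: cell_rep_eq)
    then have "b \<in> T (idx x)"
      using DR vv(2)[of x "lp (idx x)"] by (auto simp: T_def idx_in_cell)
    with idxK[OF x(1)] show "b \<in> (\<Union>k\<in>K. T k)" by auto
  next
    fix b assume "b \<in> (\<Union>k\<in>K. T k)"
    then obtain k where b: "b \<in> ?B" "vadd n b (lp k) \<in> D" by (auto simp: T_def)
    then have "cell_rep n f (vadd n b (lp k)) = b"
      using BR by (subst cell_rep_vadd_lp) (auto simp: cell_rep_cell)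
    with b(2) show "b \<in> cell_rep n f ` D" by (metis imageI)
  qed
  show ?S unfolding image using T_sets finK by auto
  have T_disj: "k = l" if "b \<in> T k" "b \<in> T l" "k \<in> K" "l \<in> K" for b k l
  proof -
    have b: "b \<in> Rsp {1..n}" using that BR by (auto simp: T_def)
    have "vadd n b (lp k) = vadd n b (lp l)"
      by (rule inj) (use that b in \<open>auto simp: T_def cell_rep_vadd_lp\<close>)
    then have vi: "vadd n b (lp k) i = vadd n b (lp l) i" for i by simp
    have eq: "lp k i = lp l i" if "i \<in> {1..n}" for i
      using vi[of i] that by (simp add: vadd_def)
    have "lp k = lp l" by (rule Rsp_eqI) (use eq in auto)
    then have "k j = l j" if "j \<in> {1..n}" for j
      using cf_lp[OF that, of k] cf_lp[OF that, of l] by simp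
    then show "k = l"
      by (intro PiE_ext[of k "{1..n}" "\<lambda>_. UNIV"]) (use that in \<open>auto simp: K_def\<close>)
  qed
  have sumD: "indicator D x *\<^sub>R g x = (\<Sum>k\<in>K. indicator (P k) x *\<^sub>R g x)" for x
  proof (cases "x \<in> D")
    case True
    have "(\<Sum>k\<in>K. indicator (P k) x *\<^sub>R g x) = (\<Sum>k\<in>K. if k = idx x then g x else 0)"
      using True by (intro sum.cong) (auto simp: indicator_def P_iff)
    then show ?thesis using True idxK[OF True] finK by simp
  next
    case False
    then show ?thesis by (auto simp: P_def intro!: sum.neutral)
  qed
  have sumT: "indicator (cell_rep n f ` D) x *\<^sub>R g x = (\<Sum>k\<in>K. indicator (T k) x *\<^sub>R g x)" for x
  proof (cases "x \<in> (\<Union>k\<in>K. T k)")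
    case True
    then obtain k where k: "k \<in> K" "x \<in> T k" by auto
    have "(\<Sum>l\<in>K. indicator (T l) x *\<^sub>R g x) = (\<Sum>l\<in>K. if l = k then g x else 0)"
      using T_disj k by (intro sum.cong) (auto simp: indicator_def)
    then show ?thesis using True k finK unfolding image by simp
  next
    case False
    then show ?thesis unfolding image by (auto intro!: sum.neutral)
  qed
  let ?S = "\<lambda>k x. vadd n x (lp k)"
  have S: "?S k \<in> measurable ?L ?L" "distr ?L ?L (?S k) = ?L" for k
    using leb_translate[of "{1..n}" "lp k"] by (auto simp: vadd_def)
  have iT: "integrable ?L (\<lambda>x. indicator (T k) x *\<^sub>R g x)" for k
  proof -
    have "integrable ?L (\<lambda>x. indicator (T k) x *\<^sub>R (indicator ?B x *\<^sub>R g x))"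
      using int sets_leb_I[OF T_sets] unfolding set_integrable_def by (rule integrable_mult_indicator[rotated])
    also have "(\<lambda>x. indicator (T k) x *\<^sub>R (indicator ?B x *\<^sub>R g x)) = (\<lambda>x. indicator (T k) x *\<^sub>R g x)"
      by (auto simp: T_def indicator_def)
    finally show ?thesis .
  qed
  have shift: "indicator (P k) (vadd n x (lp k)) *\<^sub>R g (vadd n x (lp k)) = indicator (T k) x *\<^sub>R g x"
    if "x \<in> Rsp {1..n}" for x k
  proof -
    have "g (vadd n x (lp k)) = g x"
      using periodic[of "vadd n x (lp k)"] periodic[OF that] that by (simp add: cell_rep_vadd_lp)
    moreover have "vadd n x (lp k) \<in> P k \<longleftrightarrow> x \<in> T k"
      using that by (auto simp: P_def T_def vv)
    ultimately show ?thesis by (auto simp: indicator_def)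
  qed
  have shift': "indicator (P k) x *\<^sub>R g x = indicator (T k) (vsub n x (lp k)) *\<^sub>R g (vsub n x (lp k))"
    if "x \<in> Rsp {1..n}" for x k
    using shift[of "vsub n x (lp k)" k] that by (simp add: vv)
  \<comment> \<open>Integrability of g is assumed on the cell alone, so even measurability on
    \<open>P k\<close> has to be transported from \<open>T k\<close> by the inverse
    translation.\<close>
  have mP: "(\<lambda>x. indicator (P k) x *\<^sub>R g x) \<in> borel_measurable ?L" for k
  proof -
    have "(\<lambda>x. vsub n x (lp k)) \<in> measurable ?L ?L" using S(1) by (simp add: vsub_lp)
    from measurable_compose[OF this borel_measurable_integrable[OF iT[of k]]]
    show ?thesis by (subst measurable_cong[OF shift']) auto
  qed
  have iP: "integrable ?L (\<lambda>x. indicator (P k) x *\<^sub>R g x)" for k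
  proof -
    have "integrable (distr ?L ?L (?S k)) (\<lambda>x. indicator (P k) x *\<^sub>R g x)"
      by (subst integrable_distr_eq[OF S(1) mP], subst Bochner_Integration.integrable_cong[OF refl shift])
         (auto intro: iT)
    then show ?thesis by (simp add: S(2))
  qed
  have eP: "(\<integral>x. indicator (P k) x *\<^sub>R g x \<partial>?L) = (\<integral>x. indicator (T k) x *\<^sub>R g x \<partial>?L)" for k
  proof -
    have "(\<integral>x. indicator (P k) x *\<^sub>R g x \<partial>?L) = (\<integral>x. indicator (P k) x *\<^sub>R g x \<partial>distr ?L ?L (?S k))"
      by (simp add: S(2))
    also have "\<dots> = (\<integral>x. indicator (P k) (?S k x) *\<^sub>R g (?S k x) \<partial>?L)"
      by (rule integral_distr[OF S(1) mP])
    also have "\<dots> = (\<integral>x. indicator (T k) x *\<^sub>R g x \<partial>?L)"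
      by (rule Bochner_Integration.integral_cong[OF refl]) (auto intro: shift)
    finally show ?thesis .
  qed
  show ?I unfolding set_integrable_def sumD by (intro Bochner_Integration.integrable_sum iP)
  show ?E unfolding set_lebesgue_integral_def sumD sumT
    by (simp add: Bochner_Integration.integral_sum iP iT eP)
qed

end

section \<open>The tiling of the cosets by cuboids\<close>

text \<open>The bounds on \<theta> keep the dead zone well below half a diagonal entry and make the
  rounding in \<open>coeff_bounds\<close> work. The recurring tolerance is \<rho>/9, since three
  such errors add up to the \<rho>/3 of the theorem: \<open>72 * b * C * \<zeta> \<le> 1\<close>
  yields it in \<open>lp_near_diag\<close>, and \<open>36 * C * \<zeta> \<le> \<theta>\<close> keeps
  the loss in \<open>unit_shift_decreases\<close> below it.\<close>

locale box_tiling = lattice_basis +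
  fixes C a b \<zeta> \<rho> \<theta> :: real
  assumes C_pos: "0 < C" and a_pos: "0 < a" and a_le_b: "a \<le> b"
    and f_off: "\<And>i j. i \<in> {1..n} \<Longrightarrow> j \<in> {1..n} \<Longrightarrow> i \<noteq> j \<Longrightarrow> \<bar>f j i\<bar> \<le> C / real n"
    and f_diag: "\<And>i. i \<in> {1..n} \<Longrightarrow> a \<le> f i i \<and> f i i \<le> b"
    and N_off: "\<And>i j. i \<in> {1..n} \<Longrightarrow> j \<in> {1..n} \<Longrightarrow> i \<noteq> j \<Longrightarrow> \<bar>N i j\<bar> \<le> C / real n"
    and N_diag: "\<And>i. i \<in> {1..n} \<Longrightarrow> a \<le> N i i \<and> N i i \<le> b"
    and theta: "0 < \<theta>" "8 * \<theta> \<le> a" "16 * C * \<theta> \<le> 1" "8 * b * \<theta> \<le> 1"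
    and rho: "0 < \<rho>" "4 * \<rho> \<le> \<theta>"
    and zeta: "0 < \<zeta>" "\<zeta> \<le> 1" "72 * b * C * \<zeta> \<le> 1" "36 * C * \<zeta> \<le> \<theta>"
begin

definition phi :: "real \<Rightarrow> real" where
  "phi s = max 0 (\<bar>s\<bar> - \<theta>)"

definition Phi :: "(nat \<Rightarrow> real) \<Rightarrow> real" where
  "Phi x = (\<Sum>i=1..n. phi (x i))"

text \<open>At r = \<rho>/3 this is the sum that decides which points are forced into
  \<open>Babs\<close>. At r = \<rho> it is the control imposed on representatives, and there it also
  sees coordinates inside the dead zone of \<open>phi\<close>.\<close>

definition big_sum :: "real \<Rightarrow> (nat \<Rightarrow> real) \<Rightarrow> real" where
  "big_sum r x = (\<Sum>i=1..n. \<bar>x i\<bar> * of_bool (\<bar>x i\<bar> > r))"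

text \<open>Six times the threshold \<open>1/3 * \<zeta> * real n * \<rho>\<close>. Passing from a
  point of the cell to the minimiser of its coset costs a factor of at most 4, see
  \<open>dom_exists\<close>.\<close>

definition kap :: real where "kap = 2 * \<zeta> * real n * \<rho>"

lemma n_pos: "0 < real n" using n_ge_1 by simp

lemma b_pos: "0 < b" using a_pos a_le_b by simp

lemma phi_nonneg: "0 \<le> phi s" by (simp add: phi_def)
lemma abs_le_phi: "\<bar>s\<bar> \<le> \<theta> + phi s" by (simp add: phi_def)
lemma phi_zero: "\<bar>s\<bar> \<le> \<theta> \<Longrightarrow> phi s = 0" by (simp add: phi_def)
lemma phi_diff: "phi (s - t) \<le> phi s + \<bar>t\<bar>" by (auto simp: phi_def)

lemma phi_le_big: "r \<le> \<theta> \<Longrightarrow> phi s \<le> \<bar>s\<bar> * of_bool (\<bar>s\<bar> > r)"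
  using theta by (auto simp: phi_def)

lemma Phi_le_big_sum: "r \<le> \<theta> \<Longrightarrow> Phi x \<le> big_sum r x"
  unfolding Phi_def big_sum_def by (intro sum_mono phi_le_big)

section \<open>Near-diagonal estimates for lattice shifts\<close>

lemma sum_offdiag:
  assumes i: "i \<in> {1..n}" and A: "\<And>j. j \<in> {1..n} \<Longrightarrow> i \<noteq> j \<Longrightarrow> \<bar>A j\<bar> \<le> C / real n"
  shows "\<bar>(\<Sum>j=1..n. A j * t j) - A i * t i\<bar> \<le> C / real n * (\<Sum>j=1..n. \<bar>t j\<bar>)"
proof -
  have "(\<Sum>j=1..n. A j * t j) - A i * t i = (\<Sum>j\<in>{1..n}-{i}. A j * t j)"
    using i by (subst sum.remove[of _ i]) auto
  also have "\<bar>\<dots>\<bar> \<le> (\<Sum>j\<in>{1..n}-{i}. C / real n * \<bar>t j\<bar>)"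
  proof (rule order_trans[OF sum_abs], rule sum_mono)
    fix j assume "j \<in> {1..n} - {i}"
    then show "\<bar>A j * t j\<bar> \<le> C / real n * \<bar>t j\<bar>"
      unfolding abs_mult by (intro mult_right_mono A) auto
  qed
  also have "\<dots> \<le> (\<Sum>j=1..n. C / real n * \<bar>t j\<bar>)"
    using C_pos by (intro sum_mono2) auto
  finally show ?thesis by (simp add: sum_distrib_left)
qed

lemma lincomb_near_diag:
  assumes i: "i \<in> {1..n}"
  shows "\<bar>lincomb n {1..n} t f i - f i i * t i\<bar> \<le> C / real n * (\<Sum>j=1..n. \<bar>t j\<bar>)"
  using sum_offdiag[OF i, of "\<lambda>j. f j i" t] f_off i by (simp add: lincomb_def mult.commute)

lemma cf_near_diag:
  assumes i: "i \<in> {1..n}"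
  shows "\<bar>cf x i - N i i * x i\<bar> \<le> C / real n * (\<Sum>j=1..n. \<bar>x j\<bar>)"
  using sum_offdiag[OF i, of "\<lambda>j. N i j" x] N_off i by (simp add: cf_def)

text \<open>The i-th coefficient is \<open>N i i * (x i - y i)\<close> up to an error 1/4. As it is
  an integer, being nonzero forces \<open>b * (\<bar>x i\<bar> + \<bar>y i\<bar>)\<close> to be at
  least 3/4. The two dead zones account for at most 1/4 of this, so the \<open>phi\<close> part is
  at least 1/2 and absorbs all additive errors at the cost of the factor 2.\<close>

lemma coeff_bounds:
  assumes x: "Phi x \<le> kap" and y: "Phi y \<le> kap" and yx: "y = vsub n x (lp k)" and i: "i \<in> {1..n}"
  shows coeff_le_phi: "\<bar>real_of_int (k i)\<bar> \<le> 2 * b * (phi (x i) + phi (y i))"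
    and coeff_nonzero: "k i \<noteq> 0 \<Longrightarrow> 2 * \<theta> < \<bar>x i\<bar> \<or> 2 * \<theta> < \<bar>y i\<bar>"
proof -
  let ?d = "\<lambda>j. x j - y j"
  have ki: "real_of_int (k i) = cf ?d i"
  proof -
    have "cf ?d i = cf x i - cf y i"
      by (simp add: cf_def algebra_simps sum_subtractf)
    also have "\<dots> = k i" using i by (simp add: yx cf_vsub cf_lp)
    finally show ?thesis ..
  qed
  have "(\<Sum>j=1..n. \<bar>?d j\<bar>) \<le> (\<Sum>j=1..n. 2 * \<theta> + phi (x j) + phi (y j))"
  proof (rule sum_mono)
    fix j show "\<bar>?d j\<bar> \<le> 2 * \<theta> + phi (x j) + phi (y j)"
      using abs_le_phi[of "x j"] abs_le_phi[of "y j"] by linarith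
  qed
  also have "\<dots> \<le> real n * (2 * \<theta>) + 2 * kap"
    using x y by (simp add: sum.distrib Phi_def)
  finally have "C / real n * (\<Sum>j=1..n. \<bar>?d j\<bar>) \<le> C / real n * (real n * (2 * \<theta>) + 2 * kap)"
    using C_pos by (intro mult_left_mono) auto
  also have "\<dots> = 2 * (C * \<theta>) + 4 * \<zeta> * (C * \<rho>)"
    using n_pos by (simp add: kap_def field_simps)
  also have "\<dots> \<le> 1/4"
  proof -
    have 1: "C * \<theta> \<le> 1/16" using theta by simp
    have "C * (4 * \<rho>) \<le> C * \<theta>" using rho C_pos by (intro mult_left_mono) auto
    with 1 have 2: "C * \<rho> \<le> 1/64" by simp
    have "\<zeta> * (C * \<rho>) \<le> 1 * (C * \<rho>)" using zeta C_pos rho by (intro mult_right_mono) auto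
    with 1 2 show ?thesis by linarith
  qed
  finally have near: "\<bar>real_of_int (k i) - N i i * (x i - y i)\<bar> \<le> 1/4"
    using cf_near_diag[OF i, of ?d] unfolding ki by (rule order_trans[rotated])
  have "\<bar>N i i * (x i - y i)\<bar> \<le> b * (\<bar>x i\<bar> + \<bar>y i\<bar>)"
    using N_diag[OF i] a_pos unfolding abs_mult by (intro mult_mono) auto
  with near have *: "\<bar>real_of_int (k i)\<bar> \<le> b * (\<bar>x i\<bar> + \<bar>y i\<bar>) + 1/4" by linarith
  have large: "3/4 \<le> b * (\<bar>x i\<bar> + \<bar>y i\<bar>)" if "k i \<noteq> 0"
  proof -
    have "1 \<le> \<bar>real_of_int (k i)\<bar>" using that by linarith
    with * show ?thesis by linarith
  qed
  show "\<bar>real_of_int (k i)\<bar> \<le> 2 * b * (phi (x i) + phi (y i))"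
  proof (cases "k i = 0")
    case True
    then show ?thesis using phi_nonneg[of "x i"] phi_nonneg[of "y i"] b_pos by simp
  next
    case False
    have "b * (\<bar>x i\<bar> + \<bar>y i\<bar>) \<le> b * (2 * \<theta> + (phi (x i) + phi (y i)))"
      using abs_le_phi[of "x i"] abs_le_phi[of "y i"] b_pos by (intro mult_left_mono) auto
    also have "\<dots> \<le> 1/4 + b * (phi (x i) + phi (y i))"
      using theta by (simp add: algebra_simps)
    finally show ?thesis using large[OF False] * by (simp add: algebra_simps)
  qed
  show "2 * \<theta> < \<bar>x i\<bar> \<or> 2 * \<theta> < \<bar>y i\<bar>" if "k i \<noteq> 0"
  proof (rule ccontr)
    assume "\<not> ?thesis"
    then have "b * (\<bar>x i\<bar> + \<bar>y i\<bar>) \<le> b * (4 * \<theta>)"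
      using b_pos by (intro mult_left_mono) auto
    with large[OF that] theta show False by simp
  qed
qed

lemma coeff_sum:
  assumes x: "Phi x \<le> kap" and y: "Phi y \<le> kap" and yx: "y = vsub n x (lp k)"
  shows "(\<Sum>i=1..n. \<bar>real_of_int (k i)\<bar>) \<le> 4 * b * kap"
proof -
  have "(\<Sum>i=1..n. \<bar>real_of_int (k i)\<bar>) \<le> (\<Sum>i=1..n. 2 * b * (phi (x i) + phi (y i)))"
    by (intro sum_mono coeff_le_phi[OF x y yx])
  also have "\<dots> = 2 * b * (Phi x + Phi y)"
    by (simp add: Phi_def sum_distrib_left[symmetric] sum.distrib)
  also have "\<dots> \<le> 2 * b * (kap + kap)"
    using x y b_pos by (intro mult_left_mono) auto
  finally show ?thesis by simp
qed

lemma lp_near_diag: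
  assumes x: "Phi x \<le> kap" and y: "Phi y \<le> kap" and yx: "y = vsub n x (lp k)" and i: "i \<in> {1..n}"
  shows "\<bar>x i - y i - f i i * real_of_int (k i)\<bar> \<le> \<rho> / 9"
proof -
  have "\<bar>lp k i - f i i * real_of_int (k i)\<bar> \<le> C / real n * (\<Sum>j=1..n. \<bar>real_of_int (k j)\<bar>)"
    using lincomb_near_diag[OF i, of "\<lambda>j. real_of_int (k j)"] by (simp add: lp_def)
  also have "\<dots> \<le> C / real n * (4 * b * kap)"
    using coeff_sum[OF x y yx] C_pos by (intro mult_left_mono) auto
  also have "\<dots> = 8 * b * C * \<zeta> * \<rho>"
    using n_pos by (simp add: kap_def)
  also have "\<dots> \<le> \<rho> / 9"
    using mult_right_mono[OF zeta(3), of \<rho>] rho by simp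
  finally show ?thesis using i by (simp add: yx vsub_def)
qed

text \<open>The positive cone of the lexicographic order on n-tuples of integers: closed under
  addition, and containing exactly one of k and -k when k is nonzero on
  \<open>{1..n}\<close>.\<close>

definition lexpos :: "(nat \<Rightarrow> int) \<Rightarrow> bool" where
  "lexpos k \<longleftrightarrow> (\<exists>i\<in>{1..n}. k i > 0 \<and> (\<forall>j\<in>{1..<i}. k j = 0))"

lemma lexpos_total:
  assumes "\<exists>i\<in>{1..n}. k i \<noteq> 0" "\<not> lexpos k"
  shows "lexpos (\<lambda>j. - k j)"
proof -
  define i where "i = (LEAST i. i \<in> {1..n} \<and> k i \<noteq> 0)"
  have i: "i \<in> {1..n} \<and> k i \<noteq> 0"
    unfolding i_def by (rule LeastI_ex) (use assms in auto)
  have least: "k j = 0" if "j \<in> {1..<i}" for j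
  proof -
    have "j < (LEAST i. i \<in> {1..n} \<and> k i \<noteq> 0)" using that by (simp add: i_def)
    from not_less_Least[OF this] show ?thesis using that i by auto
  qed
  have "\<not> 0 < k i" using assms(2) i least by (auto simp: lexpos_def)
  then show ?thesis using i least unfolding lexpos_def by (intro bexI[of _ i]) auto
qed

lemma lexpos_asym: "lexpos k \<Longrightarrow> \<not> lexpos (\<lambda>j. - k j)"
  unfolding lexpos_def
proof (safe)
  fix i i' assume "i \<in> {1..n}" "0 < k i" "\<forall>j\<in>{1..<i}. k j = 0"
    "i' \<in> {1..n}" "0 < - k i'" "\<forall>j\<in>{1..<i'}. - k j = 0"
  then show False by (cases i i' rule: linorder_cases) auto
qed

lemma lexpos_add: "lexpos k \<Longrightarrow> lexpos l \<Longrightarrow> lexpos (\<lambda>j. k j + l j)"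
  unfolding lexpos_def
proof (safe)
  fix i i' assume *: "i \<in> {1..n}" "0 < k i" "\<forall>j\<in>{1..<i}. k j = 0"
    "i' \<in> {1..n}" "0 < l i'" "\<forall>j\<in>{1..<i'}. l j = 0"
  then show "\<exists>i\<in>{1..n}. k i + l i > 0 \<and> (\<forall>j\<in>{1..<i}. k j + l j = 0)"
    by (intro bexI[of _ "min i i'"]; cases i i' rule: linorder_cases) auto
qed

text \<open>The point x is preferred to its translate by \<open>- lp k\<close>. A tie is decided by
  the shift alone and not by the points, so that altering small coordinates of x cannot change the
  outcome.\<close>

definition better :: "(nat \<Rightarrow> real) \<Rightarrow> (nat \<Rightarrow> int) \<Rightarrow> bool" where
  "better x k \<longleftrightarrow> Phi x < Phi (vsub n x (lp k)) \<or> Phi x = Phi (vsub n x (lp k)) \<and> lexpos k"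

(* Minimality is only required against shifts k in {-1,0,1}^n supported on the coordinates
   above 2\<theta>: this makes the condition manifestly independent of the small coordinates, and the
   bounds on x force any other point of the coset satisfying them to differ by such a shift. *)
definition fund_dom :: "(nat \<Rightarrow> real) set" where
  "fund_dom = {x \<in> Rsp {1..n}. big_sum \<rho> x \<le> kap \<and> (\<forall>j\<in>{1..n}. \<bar>x j\<bar> \<le> f j j / 2 + \<rho> / 9) \<and>
     (\<forall>k\<in>{1..n} \<rightarrow>\<^sub>E {-1, 0, 1}. (\<exists>i\<in>{1..n}. k i \<noteq> 0) \<longrightarrow>
        (\<forall>i\<in>{1..n}. k i \<noteq> 0 \<longrightarrow> 2 * \<theta> < \<bar>x i\<bar>) \<longrightarrow> better x k)}"

section \<open>Uniqueness of representatives and independence of small coordinates\<close>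

lemma rho_le_theta: "\<rho> \<le> \<theta>" using rho by linarith

lemma better_asym:
  assumes x: "x \<in> Rsp {1..n}" and "better x k"
  shows "\<not> better (vsub n x (lp k)) (\<lambda>j. - k j)"
proof -
  have "vsub n (vsub n x (lp k)) (lp (\<lambda>j. - k j)) = x"
    by (rule Rsp_eqI[OF _ x]) (simp_all add: vsub_def lp_apply sum_negf)
  then show ?thesis using assms lexpos_asym[of k] by (auto simp: better_def)
qed

text \<open>If \<open>\<bar>k i\<bar>\<close> were at least 2, x and y would be further apart in
  coordinate i than their bounds \<open>f i i / 2 + \<rho> / 9\<close> allow. If it is 1, the
  difference is nearly \<open>f i i\<close>, so both points are close to the extreme values and
  exceed 2\<theta> there. Hence k is an admissible competitor at x and -k at y, and each point would
  have to be strictly preferred to the other.\<close>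

lemma dom_unique:
  assumes x: "x \<in> fund_dom" and y: "y \<in> fund_dom" and eq: "cell_rep n f x = cell_rep n f y"
  shows "x = y"
proof -
  have xR: "x \<in> Rsp {1..n}" and yR: "y \<in> Rsp {1..n}" using x y by (auto simp: fund_dom_def)
  obtain k where k: "k \<in> {1..n} \<rightarrow>\<^sub>E UNIV" and yx: "y = vsub n x (lp k)"
    using cell_rep_eqE[OF xR yR eq] .
  have Px: "Phi x \<le> kap" and Py: "Phi y \<le> kap"
    using Phi_le_big_sum[OF rho_le_theta, of x] Phi_le_big_sum[OF rho_le_theta, of y] x y
    by (auto simp: fund_dom_def)
  have near: "\<bar>x i - y i - f i i * real_of_int (k i)\<bar> \<le> \<rho> / 9" if "i \<in> {1..n}" for i
    by (rule lp_near_diag[OF Px Py yx that])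
  have bd: "\<bar>x i\<bar> \<le> f i i / 2 + \<rho> / 9" "\<bar>y i\<bar> \<le> f i i / 2 + \<rho> / 9" "32 * \<rho> \<le> f i i"
    if "i \<in> {1..n}" for i
    using x y that f_diag[OF that] theta rho by (auto simp: fund_dom_def)
  have k1: "k i \<in> {-1, 0, 1}" if i: "i \<in> {1..n}" for i
  proof (rule ccontr)
    assume "k i \<notin> {-1, 0, 1}"
    then have "2 \<le> \<bar>real_of_int (k i)\<bar>" by auto
    then have "f i i * 2 \<le> \<bar>f i i * real_of_int (k i)\<bar>"
      unfolding abs_mult using bd(3)[OF i] rho by (intro mult_mono) auto
    then show False using near[OF i] bd[OF i] rho by linarith
  qed
  have large: "2 * \<theta> < \<bar>x i\<bar> \<and> 2 * \<theta> < \<bar>y i\<bar>" if i: "i \<in> {1..n}" and "k i \<noteq> 0" for i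
  proof -
    have "\<bar>f i i * real_of_int (k i)\<bar> = f i i"
      using k1[OF i] that bd(3)[OF i] rho by (auto simp: abs_mult)
    moreover have "8 * \<theta> \<le> f i i" using f_diag[OF i] theta by linarith
    ultimately show ?thesis
      using near[OF i] bd[OF i] rho theta by linarith
  qed
  show ?thesis
  proof (cases "\<exists>i\<in>{1..n}. k i \<noteq> 0")
    case False
    then show ?thesis
      using xR yR by (intro Rsp_eqI) (auto simp: yx vsub_def lp_apply)
  next
    case True
    have "k \<in> {1..n} \<rightarrow>\<^sub>E {-1, 0, 1}"
      using k k1 by (auto simp: PiE_iff)
    then have "better x k"
      using x True large by (auto simp: fund_dom_def)
    moreover
    \<comment> \<open>This is -k made extensional, as the quantifier in \<open>fund_dom\<close>
      demands.\<close>
    define l where "l = (\<lambda>j\<in>{1..n}. - k j)"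
    have "l \<in> {1..n} \<rightarrow>\<^sub>E {-1, 0, 1}"
      using k1 by (fastforce simp: l_def PiE_iff)
    then have "better y l"
      using y True large by (auto simp: fund_dom_def l_def)
    then have "better y (\<lambda>j. - k j)"
    proof -
      have "lp l = lp (\<lambda>j. - k j)" by (rule lp_cong) (simp add: l_def)
      moreover have "lexpos l = lexpos (\<lambda>j. - k j)"
        unfolding lexpos_def by (intro bex_cong refl) (auto simp: l_def)
      ultimately show ?thesis using \<open>better y l\<close> by (simp add: better_def)
    qed
    ultimately show ?thesis using better_asym[OF xR, of k] yx by simp
  qed
qed

text \<open>Each index in the support of an admissible shift uses up 2\<theta> of the budget
  \<open>kap\<close>, so the support has at most kap/(2\<theta>) elements and moves any coordinate
  outside it by at most \<rho>. A coordinate that was at most \<rho> ends up at most 2\<rho> \<le>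
  \<theta>, in the dead zone, for x and y alike; the other coordinates of x and y coincide. Both
  sides of the comparison thus have the same \<open>Phi\<close> values.\<close>

lemma dom_slice_full:
  assumes x: "x \<in> fund_dom" and y: "y \<in> Rsp {1..n}"
    and big: "\<And>i. i \<in> {1..n} \<Longrightarrow> \<rho> < \<bar>x i\<bar> \<Longrightarrow> y i = x i"
    and small: "\<And>i. i \<in> {1..n} \<Longrightarrow> \<bar>x i\<bar> \<le> \<rho> \<Longrightarrow> \<bar>y i\<bar> \<le> \<rho>"
  shows "y \<in> fund_dom"
proof -
  have iff: "\<bar>y i\<bar> > r \<longleftrightarrow> \<bar>x i\<bar> > r" if "i \<in> {1..n}" "\<rho> \<le> r" for i r
    using big[OF that(1)] small[OF that(1)] that(2) by (cases "\<rho> < \<bar>x i\<bar>") auto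
  have eq1: "big_sum \<rho> y = big_sum \<rho> x"
    unfolding big_sum_def
  proof (rule sum.cong[OF refl])
    fix i assume i: "i \<in> {1..n}"
    show "\<bar>y i\<bar> * of_bool (\<rho> < \<bar>y i\<bar>) = \<bar>x i\<bar> * of_bool (\<rho> < \<bar>x i\<bar>)"
      using iff[OF i, of \<rho>] big[OF i] by auto
  qed
  have eq2: "Phi y = Phi x"
    unfolding Phi_def
  proof (rule sum.cong[OF refl])
    fix i assume i: "i \<in> {1..n}"
    show "phi (y i) = phi (x i)"
    proof (cases "\<rho> < \<bar>x i\<bar>")
      case False
      then show ?thesis using small[OF i] rho_le_theta by (simp add: phi_zero)
    qed (use big[OF i] in simp)
  qed
  have bd: "\<bar>y j\<bar> \<le> f j j / 2 + \<rho> / 9" if j: "j \<in> {1..n}" for j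
  proof (cases "\<rho> < \<bar>x j\<bar>")
    case True
    then show ?thesis using big[OF j] x j by (auto simp: fund_dom_def)
  next
    case False
    then show ?thesis using small[OF j] f_diag[OF j] theta rho by linarith
  qed
  have "better y k"
    if k: "k \<in> {1..n} \<rightarrow>\<^sub>E {-1, 0, 1}" and k0: "\<exists>i\<in>{1..n}. k i \<noteq> 0"
      and ky: "\<forall>i\<in>{1..n}. k i \<noteq> 0 \<longrightarrow> 2 * \<theta> < \<bar>y i\<bar>" for k
  proof -
    have kx: "\<forall>i\<in>{1..n}. k i \<noteq> 0 \<longrightarrow> 2 * \<theta> < \<bar>x i\<bar>"
      using ky iff[of _ "2 * \<theta>"] rho_le_theta theta by auto
    have bx: "better x k" using x k k0 kx by (auto simp: fund_dom_def)
    have "(\<Sum>j=1..n. 2 * \<theta> * \<bar>real_of_int (k j)\<bar>) \<le> big_sum \<rho> x"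
      unfolding big_sum_def
    proof (rule sum_mono)
      fix j assume j: "j \<in> {1..n}"
      have "k j \<in> {-1, 0, 1}" using k j by (auto simp: PiE_iff)
      then show "2 * \<theta> * \<bar>real_of_int (k j)\<bar> \<le> \<bar>x j\<bar> * of_bool (\<rho> < \<bar>x j\<bar>)"
        using kx j rho_le_theta theta by (cases "k j = 0") (auto simp: abs_if split: if_splits)
    qed
    also have "\<dots> \<le> kap" using x by (simp add: fund_dom_def)
    finally have ks: "2 * \<theta> * (\<Sum>j=1..n. \<bar>real_of_int (k j)\<bar>) \<le> kap"
      by (simp add: sum_distrib_left)
    have small_lp: "\<bar>lp k i\<bar> \<le> \<rho>" if i: "i \<in> {1..n}" and ki: "k i = 0" for i
    proof -
      have "\<bar>lp k i\<bar> \<le> C / real n * (\<Sum>j=1..n. \<bar>real_of_int (k j)\<bar>)"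
        using lincomb_near_diag[OF i, of "\<lambda>j. real_of_int (k j)"] ki by (simp add: lp_def)
      also have "\<dots> \<le> C / real n * (kap / (2 * \<theta>))"
        using ks theta C_pos by (intro mult_left_mono) (auto simp: field_simps)
      also have "\<dots> = C * \<zeta> / \<theta> * \<rho>"
        using n_pos by (simp add: kap_def)
      also have "\<dots> \<le> 1 * \<rho>"
        using zeta C_pos theta rho by (intro mult_right_mono) (auto simp: field_simps)
      finally show ?thesis by simp
    qed
    have "Phi (vsub n y (lp k)) = Phi (vsub n x (lp k))"
      unfolding Phi_def
    proof (rule sum.cong[OF refl])
      fix i assume i: "i \<in> {1..n}"
      show "phi (vsub n y (lp k) i) = phi (vsub n x (lp k) i)"
      proof (cases "\<rho> < \<bar>x i\<bar>")
        case True
        then show ?thesis using big[OF i] i by (simp add: vsub_def)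
      next
        case False
        have "\<not> 2 * \<theta> < \<bar>x i\<bar>" using False rho_le_theta theta by linarith
        with kx i have "k i = 0" by blast
        have "phi (vsub n y (lp k) i) = 0" "phi (vsub n x (lp k) i) = 0"
          using small_lp[OF i \<open>k i = 0\<close>] small[OF i] False rho i
          by (auto simp: vsub_def intro!: phi_zero)
        then show ?thesis by simp
      qed
    qed
    with bx eq2 show ?thesis by (simp add: better_def)
  qed
  then show ?thesis using y eq1 bd x by (auto simp: fund_dom_def)
qed

section \<open>Existence of representatives for sparse cosets\<close>

lemma lexpos_cong: "(\<And>j. j \<in> {1..n} \<Longrightarrow> k j = l j) \<Longrightarrow> lexpos k = lexpos l"
  unfolding lexpos_def by (intro bex_cong refl) auto

text \<open>By \<open>coeff_sum\<close>, only finitely many lattice shifts of u do not increase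
  \<open>Phi\<close>, so a strict partial order on them has a minimal element; totality of the
  lexicographic order turns minimality into preference over every other shift.\<close>

lemma ex_lattice_minimiser:
  assumes u: "u \<in> Rsp {1..n}" and Pu: "Phi u \<le> kap"
  obtains k where "Phi (vsub n u (lp k)) \<le> Phi u"
    "\<And>l. \<exists>i\<in>{1..n}. l i \<noteq> 0 \<Longrightarrow> better (vsub n u (lp k)) l"
proof -
  let ?s = "\<lambda>k. vsub n u (lp k)"
  define A where "A = {k \<in> {1..n} \<rightarrow>\<^sub>E UNIV. Phi (?s k) \<le> Phi u}"
  \<comment> \<open>Preference between two translates of u, expressed through the difference of
    their shifts; transitivity of the tie-break is then additivity of \<open>lexpos\<close>.\<close>
  define R where "R k l \<longleftrightarrow> Phi (?s k) < Phi (?s l) \<or> Phi (?s k) = Phi (?s l) \<and> lexpos (\<lambda>j. l j - k j)" for k l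
  define m where "m = \<lceil>4 * b * kap\<rceil>"
  have "A \<subseteq> {1..n} \<rightarrow>\<^sub>E {-m..m}"
  proof
    fix k assume k: "k \<in> A"
    have "k i \<in> {-m..m}" if i: "i \<in> {1..n}" for i
    proof -
      have "\<bar>real_of_int (k i)\<bar> \<le> (\<Sum>i=1..n. \<bar>real_of_int (k i)\<bar>)"
        using i by (intro member_le_sum[of i "{1..n}" "\<lambda>i. \<bar>real_of_int (k i)\<bar>"]) auto
      also have "\<dots> \<le> 4 * b * kap"
        using k Pu by (intro coeff_sum[OF Pu, of "?s k"]) (auto simp: A_def)
      finally show ?thesis unfolding m_def by (auto simp: abs_le_iff) linarith+
    qed
    then show "k \<in> {1..n} \<rightarrow>\<^sub>E {-m..m}" using k by (auto simp: A_def PiE_iff)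
  qed
  then have "finite A" by (rule finite_subset) (intro finite_PiE; simp)
  moreover have "asymp_on A R"
  proof (rule asymp_onI)
    fix k l assume "R k l"
    then show "\<not> R l k"
      using lexpos_asym[of "\<lambda>j. l j - k j"] by (auto simp: R_def)
  qed
  moreover have "transp_on A R"
  proof (rule transp_onI)
    fix k l p assume "R k l" "R l p"
    moreover have "lexpos (\<lambda>j. p j - k j)" if "lexpos (\<lambda>j. l j - k j)" "lexpos (\<lambda>j. p j - l j)"
      using lexpos_add[OF that] by simp
    ultimately show "R k p" by (auto simp: R_def)
  qed
  moreover have "(\<lambda>j\<in>{1..n}. 0) \<in> A"
  proof -
    have "?s (\<lambda>j\<in>{1..n}. 0) = u"
      by (rule Rsp_eqI[OF _ u]) (simp_all add: vsub_def lp_apply)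
    then show ?thesis by (simp add: A_def)
  qed
  ultimately obtain k where k: "k \<in> A" and min: "\<And>l. l \<in> A \<Longrightarrow> l \<noteq> k \<Longrightarrow> \<not> R l k"
    using Finite_Set.bex_min_element[of A R] by blast
  show ?thesis
  proof
    show "Phi (?s k) \<le> Phi u" using k by (simp add: A_def)
    fix l assume l: "\<exists>i\<in>{1..n}. l i \<noteq> (0::int)"
    define p where "p = (\<lambda>j\<in>{1..n}. k j + l j)"
    have sp: "?s p = vsub n (?s k) (lp l)"
    proof -
      have "lp p = vadd n (lp k) (lp l)"
        unfolding lp_add[symmetric] by (rule lp_cong) (simp add: p_def)
      then show ?thesis by (simp add: vsub_vsub)
    qed
    show "better (?s k) l"
    proof (cases "Phi (?s k) < Phi (?s p)")
      case True
      then show ?thesis by (simp add: better_def sp)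
    next
      case False
      have "p \<in> A" using False k by (auto simp: A_def p_def)
      moreover have "p \<noteq> k"
      proof -
        obtain i where "i \<in> {1..n}" "l i \<noteq> 0" using l by blast
        then have "p i \<noteq> k i" by (simp add: p_def)
        then show ?thesis by auto
      qed
      ultimately have nR: "\<not> R p k" by (rule min)
      have "lexpos (\<lambda>j. k j - p j) = lexpos (\<lambda>j. - l j)"
        by (rule lexpos_cong) (simp add: p_def)
      with nR False have "Phi (?s k) = Phi (?s p)" "\<not> lexpos (\<lambda>j. - l j)"
        by (auto simp: R_def)
      moreover have "lexpos l"
        using lexpos_total[of "\<lambda>j. - l j"] l calculation(2) by auto
      ultimately show ?thesis by (simp add: better_def sp)
    qed
  qed
qed

text \<open>Subtracting or adding the j-th basis vector nearly reflects coordinate j past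
  \<open>f j j / 2\<close>; its excess of more than \<rho>/9 is gained twice. Any other coordinate
  moves by at most C/n, and only those above \<theta>/2 can raise \<open>Phi\<close>. Because
  \<open>big_sum\<close> is small there are so few of these that the total loss is at most
  \<rho>/9.\<close>

lemma unit_shift_decreases:
  assumes x: "big_sum \<rho> x \<le> kap" and j: "j \<in> {1..n}" and xj: "f j j / 2 + \<rho> / 9 < \<bar>x j\<bar>"
  shows "\<exists>k. (\<exists>i\<in>{1..n}. k i \<noteq> 0) \<and> Phi (vsub n x (lp k)) < Phi x"
proof -
  define s :: int where "s = (if x j > 0 then 1 else -1)"
  define k where "k = (\<lambda>i. if i = j then s else 0)"
  let ?y = "vsub n x (lp k)"
  have lpk: "lp k i = real_of_int s * f j i" if "i \<in> {1..n}" for i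
    using that j by (simp add: lp_apply k_def if_distrib[of real_of_int] if_distrib[of "\<lambda>c. c * _"] cong: if_cong)
  have s1: "\<bar>real_of_int s\<bar> = 1" by (simp add: s_def)
  have fj: "8 * \<theta> \<le> f j j" using f_diag[OF j] theta by linarith
  have xj': "4 * \<theta> < \<bar>x j\<bar>" using xj fj rho by linarith
  have yj: "phi (?y j) \<le> phi (x j) - 2 * \<rho> / 9"
  proof -
    have "\<bar>?y j\<bar> = \<bar>\<bar>x j\<bar> - f j j\<bar>"
      using lpk[OF j] j by (auto simp: vsub_def s_def)
    also have "\<dots> \<le> \<bar>x j\<bar> - 2 * \<rho> / 9" using xj fj rho by linarith
    finally show ?thesis using xj' rho theta by (auto simp: phi_def)
  qed
  \<comment> \<open>No lower bound on n is assumed beyond 1. It arises here: one coordinate above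
    4\<theta> fits into the budget \<open>kap\<close>, proportional to n, only if n is large enough
    to make C/n tiny compared with \<rho>.\<close>
  have "\<bar>x j\<bar> \<le> big_sum \<rho> x"
  proof -
    have "\<bar>x j\<bar> * of_bool (\<bar>x j\<bar> > \<rho>) \<le> big_sum \<rho> x"
      unfolding big_sum_def by (rule member_le_sum[OF j]) auto
    then show ?thesis using xj' rho theta by (simp add: of_bool_def split: if_splits)
  qed
  with xj' x have "4 * \<theta> \<le> kap" by linarith
  then have "C / real n * (4 * \<theta>) \<le> C / real n * kap"
    using C_pos by (intro mult_left_mono) auto
  also have "\<dots> = 2 * (C * \<zeta>) * \<rho>" using n_pos by (simp add: kap_def)
  also have "\<dots> \<le> (\<theta> / 18) * \<rho>" using zeta rho by (intro mult_right_mono) auto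
  also have "\<dots> = \<rho> / 72 * (4 * \<theta>)" by simp
  finally have Cn: "C / real n \<le> \<rho> / 72"
    by (rule mult_right_le_imp_le) (use theta in simp)
  \<comment> \<open>The loss C/n of a coordinate above \<theta>/2 is charged to that coordinate
    itself; c is C/n divided by \<theta>/2.\<close>
  define c where "c = 2 * C / (real n * \<theta>)"
  have c0: "0 \<le> c" using C_pos theta by (simp add: c_def)
  have yi: "phi (?y i) \<le> phi (x i) + c * (\<bar>x i\<bar> * of_bool (\<bar>x i\<bar> > \<rho>))" if i: "i \<in> {1..n}" and ij: "i \<noteq> j" for i
  proof -
    have l: "\<bar>lp k i\<bar> \<le> C / real n"
      using lpk[OF i] f_off[OF i j ij] s1 by (simp add: abs_mult)
    have y: "?y i = x i - lp k i" using i by (simp add: vsub_def)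
    show ?thesis
    proof (cases "\<bar>x i\<bar> \<le> \<theta> / 2")
      case True
      then have "phi (?y i) = 0"
        using l Cn rho theta unfolding y by (intro phi_zero) linarith
      then show ?thesis using phi_nonneg c0 by simp
    next
      case False
      then have "C / real n \<le> c * \<bar>x i\<bar>"
        using C_pos theta n_pos by (simp add: c_def field_simps)
      moreover have "\<rho> < \<bar>x i\<bar>" using False rho by linarith
      ultimately show ?thesis using phi_diff[of "x i" "lp k i"] l unfolding y by simp
    qed
  qed
  have "Phi ?y = phi (?y j) + (\<Sum>i\<in>{1..n}-{j}. phi (?y i))"
    unfolding Phi_def using j by (subst sum.remove[of _ j]) auto
  also have "\<dots> \<le> (phi (x j) - 2 * \<rho> / 9) + (\<Sum>i\<in>{1..n}-{j}. phi (x i) + c * (\<bar>x i\<bar> * of_bool (\<bar>x i\<bar> > \<rho>)))"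
    by (intro add_mono yj sum_mono yi) auto
  also have "\<dots> = Phi x - 2 * \<rho> / 9 + c * (\<Sum>i\<in>{1..n}-{j}. \<bar>x i\<bar> * of_bool (\<bar>x i\<bar> > \<rho>))"
    unfolding Phi_def using j by (subst sum.remove[of "{1..n}" j]) (auto simp: sum.distrib sum_distrib_left[symmetric])
  also have "\<dots> \<le> Phi x - 2 * \<rho> / 9 + c * big_sum \<rho> x"
    unfolding big_sum_def using c0 by (intro add_left_mono mult_left_mono sum_mono2) auto
  also have "\<dots> \<le> Phi x - 2 * \<rho> / 9 + c * kap"
    using x c0 by (intro add_left_mono mult_left_mono) auto
  also have "c * kap = 4 * (C * \<zeta>) / \<theta> * \<rho>"
    using n_pos by (simp add: c_def kap_def)
  also have "\<dots> \<le> 1/9 * \<rho>"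
    using zeta theta rho by (intro mult_right_mono) (auto simp: field_simps)
  finally have "Phi ?y < Phi x" using rho by simp
  moreover have "\<exists>i\<in>{1..n}. k i \<noteq> 0"
    using j by (auto simp: k_def s_def intro!: bexI[of _ j])
  ultimately show ?thesis by blast
qed

text \<open>The minimiser x of the coset works. Its coordinates above 2\<theta> are at most twice
  their \<open>phi\<close>, hence controlled by minimality. Those between \<rho> and 2\<theta>,
  which \<open>Phi\<close> may miss, are inherited from u: a zero coefficient means that u differs
  there by at most \<rho>/9, and a nonzero one that u exceeds 2\<theta> there, so
  \<open>\<bar>x j\<bar> \<le> 2 * \<bar>u j\<bar>\<close> either way. The coordinatewise bound
  holds since a violation would allow a decreasing shift.\<close>

lemma dom_exists:
  assumes u: "u \<in> Rsp {1..n}" and small: "big_sum (\<rho> / 3) u \<le> 1/3 * \<zeta> * real n * \<rho>"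
  obtains k where "vsub n u (lp k) \<in> fund_dom"
proof -
  have Pu': "Phi u \<le> 1/3 * \<zeta> * real n * \<rho>"
    using Phi_le_big_sum[of "\<rho> / 3" u] rho small by linarith
  have kap0: "0 \<le> kap" using zeta rho by (simp add: kap_def)
  have kap6: "1/3 * \<zeta> * real n * \<rho> = kap / 6" by (simp add: kap_def)
  have Pu: "Phi u \<le> kap" using Pu' kap0 unfolding kap6 by linarith
  obtain k where k: "Phi (vsub n u (lp k)) \<le> Phi u"
    "\<And>l. \<exists>i\<in>{1..n}. l i \<noteq> 0 \<Longrightarrow> better (vsub n u (lp k)) l"
    using ex_lattice_minimiser[OF u Pu] by metis
  define x where "x = vsub n u (lp k)"
  have Px: "Phi x \<le> kap" using k(1) Pu by (simp add: x_def)
  have "big_sum \<rho> x \<le> (\<Sum>j=1..n. 2 * phi (x j) + 2 * (\<bar>u j\<bar> * of_bool (\<bar>u j\<bar> > \<rho> / 3)))"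
    unfolding big_sum_def
  proof (rule sum_mono)
    fix j assume j: "j \<in> {1..n}"
    note near = lp_near_diag[OF Pu Px x_def j]
    note nonzero = coeff_nonzero[OF Pu Px x_def j]
    show "\<bar>x j\<bar> * of_bool (\<rho> < \<bar>x j\<bar>) \<le> 2 * phi (x j) + 2 * (\<bar>u j\<bar> * of_bool (\<bar>u j\<bar> > \<rho> / 3))"
    proof (cases "\<bar>x j\<bar> \<le> \<rho> \<or> 2 * \<theta> < \<bar>x j\<bar>")
      case True
      then show ?thesis using phi_nonneg[of "x j"] by (auto simp: phi_def)
    next
      case False
      have "\<bar>u j\<bar> > \<rho> / 3 \<and> \<bar>x j\<bar> \<le> 2 * \<bar>u j\<bar>"
      proof (cases "k j = 0")
        case True
        then have "\<bar>u j - x j\<bar> \<le> \<rho> / 9" using near by simp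
        then show ?thesis using False rho by linarith
      next
        case False
        then show ?thesis using nonzero \<open>\<not> (\<bar>x j\<bar> \<le> \<rho> \<or> 2 * \<theta> < \<bar>x j\<bar>)\<close> rho theta by linarith
      qed
      then show ?thesis using phi_nonneg[of "x j"] by (simp add: of_bool_def)
    qed
  qed
  also have "\<dots> = 2 * Phi x + 2 * big_sum (\<rho> / 3) u"
    by (simp add: Phi_def big_sum_def sum.distrib sum_distrib_left[symmetric])
  also have "\<dots> \<le> kap"
    using k(1) Pu' small kap0 unfolding kap6 x_def by linarith
  finally have Qx: "big_sum \<rho> x \<le> kap" .
  have "\<bar>x j\<bar> \<le> f j j / 2 + \<rho> / 9" if j: "j \<in> {1..n}" for j
  proof (rule ccontr)
    assume "\<not> ?thesis"
    then obtain l where "\<exists>i\<in>{1..n}. l i \<noteq> 0" "Phi (vsub n x (lp l)) < Phi x"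
      using unit_shift_decreases[OF Qx j] by (auto simp: not_le)
    then show False using k(2)[of l] by (auto simp: better_def x_def)
  qed
  then have "x \<in> fund_dom" using Qx k(2) by (auto simp: fund_dom_def x_def)
  then show ?thesis unfolding x_def by (rule that)
qed

text \<open>The nearby cell point has coefficients \<open>w j / f j j\<close>, clipped to just below
  1/2. The distance collects three errors of \<rho>/9: the excess of \<open>\<bar>w j\<bar>\<close>
  over \<open>f j j / 2\<close>, the clipping margin, and the off-diagonal part. The last is small
  because sparsity of w bounds its l1 norm by \<open>kap\<close>.\<close>

lemma dom_truncation_near_cell:
  assumes w: "w \<in> fund_dom" and sparse: "\<And>j. j \<in> {1..n} \<Longrightarrow> w j = 0 \<or> \<rho> < \<bar>w j\<bar>"
  shows "w \<in> minkowski_sum n (basic_cell n f) (Ubox n (1/3 * \<rho>))"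
proof -
  have wR: "w \<in> Rsp {1..n}" using w by (simp add: fund_dom_def)
  \<comment> \<open>Clipping strictly below 1/2 avoids the missing face of the half-open cell; the
    margin \<tau> moves a coordinate by at most b\<tau> = \<rho>/9.\<close>
  define \<tau> where "\<tau> = \<rho> / (9 * b)"
  have tau: "0 < \<tau>" "\<tau> \<le> 1/4"
  proof -
    show "0 < \<tau>" using rho b_pos by (simp add: \<tau>_def)
    have "\<rho> * 4 \<le> b * 9" using rho theta a_le_b by linarith
    then show "\<tau> \<le> 1/4" using b_pos by (simp add: \<tau>_def field_simps)
  qed
  define t where "t j = sgn (w j) * min (\<bar>w j\<bar> / f j j) (1/2 - \<tau>)" for j
  have fpos: "0 < f j j" "a \<le> f j j" "f j j \<le> b" if "j \<in> {1..n}" for j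
    using f_diag[OF that] a_pos by auto
  have abs_t: "\<bar>t j\<bar> = min (\<bar>w j\<bar> / f j j) (1/2 - \<tau>)" if j: "j \<in> {1..n}" for j
  proof -
    have "0 \<le> min (\<bar>w j\<bar> / f j j) (1/2 - \<tau>)" using fpos[OF j] tau by simp
    then show ?thesis using fpos[OF j] tau by (auto simp: t_def abs_mult sgn_if)
  qed
  define z where "z = lincomb n {1..n} t f"
  have z: "z \<in> basic_cell n f"
    unfolding z_def basic_cell_def
  proof (intro CollectI exI[of _ t] conjI ballI refl)
    fix j assume "j \<in> {1..n}"
    then have "\<bar>t j\<bar> < 1/2" using abs_t[of j] tau by linarith
    then show "- (1/2) < t j" "t j \<le> 1/2" by auto
  qed
  have "(\<Sum>j=1..n. \<bar>t j\<bar>) \<le> (\<Sum>j=1..n. (\<bar>w j\<bar> * of_bool (\<bar>w j\<bar> > \<rho>)) / a)"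
  proof (rule sum_mono)
    fix j assume j: "j \<in> {1..n}"
    have "\<bar>t j\<bar> \<le> \<bar>w j\<bar> / f j j" using abs_t[OF j] by simp
    also have "\<dots> \<le> \<bar>w j\<bar> / a" using fpos[OF j] a_pos by (intro divide_left_mono) auto
    finally show "\<bar>t j\<bar> \<le> (\<bar>w j\<bar> * of_bool (\<bar>w j\<bar> > \<rho>)) / a" using sparse[OF j] by auto
  qed
  also have "\<dots> \<le> kap / a"
    using w a_pos by (simp add: fund_dom_def big_sum_def sum_divide_distrib[symmetric] divide_right_mono)
  finally have "C / real n * (\<Sum>j=1..n. \<bar>t j\<bar>) \<le> C / real n * (kap / a)"
    using C_pos by (intro mult_left_mono) auto
  also have "\<dots> = 2 * (C * \<zeta>) / a * \<rho>" using n_pos by (simp add: kap_def)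
  also have "\<dots> \<le> 1/9 * \<rho>"
    using zeta theta a_pos rho by (intro mult_right_mono) (auto simp: field_simps)
  finally have off: "C / real n * (\<Sum>j=1..n. \<bar>t j\<bar>) \<le> \<rho> / 9" by simp
  have diag: "\<bar>w i - f i i * t i\<bar> \<le> 2 * \<rho> / 9" if i: "i \<in> {1..n}" for i
  proof -
    have "w i = sgn (w i) * \<bar>w i\<bar>" by (simp add: sgn_mult_abs)
    then have "w i - f i i * t i = sgn (w i) * (\<bar>w i\<bar> - f i i * min (\<bar>w i\<bar> / f i i) (1/2 - \<tau>))"
      by (simp add: t_def algebra_simps)
    moreover have "\<bar>sgn (w i)\<bar> \<le> 1" by (simp add: sgn_if)
    ultimately have "\<bar>w i - f i i * t i\<bar> \<le> 1 * \<bar>\<bar>w i\<bar> - f i i * min (\<bar>w i\<bar> / f i i) (1/2 - \<tau>)\<bar>"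
      by (simp only: abs_mult) (intro mult_right_mono; simp)
    then have "\<bar>w i - f i i * t i\<bar> \<le> \<bar>\<bar>w i\<bar> - f i i * min (\<bar>w i\<bar> / f i i) (1/2 - \<tau>)\<bar>"
      by (simp only: mult_1)
    also have "f i i * min (\<bar>w i\<bar> / f i i) (1/2 - \<tau>) = min \<bar>w i\<bar> (f i i * (1/2 - \<tau>))"
      using fpos[OF i] by (auto simp: min_mult_distrib_left)
    also have "\<bar>\<bar>w i\<bar> - min \<bar>w i\<bar> (f i i * (1/2 - \<tau>))\<bar> \<le> \<rho> / 9 + f i i * \<tau>"
    proof -
      have "\<bar>w i\<bar> \<le> f i i / 2 + \<rho> / 9" using w i by (simp add: fund_dom_def)
      moreover have "f i i * (1/2 - \<tau>) = f i i / 2 - f i i * \<tau>" by (simp add: algebra_simps)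
      moreover have "0 \<le> f i i * \<tau>" using fpos[OF i] tau by simp
      ultimately show ?thesis using rho by (simp add: min_def)
    qed
    also have "f i i * \<tau> \<le> b * \<tau>" using fpos[OF i] tau by (intro mult_right_mono) auto
    also have "b * \<tau> = \<rho> / 9" using b_pos by (simp add: \<tau>_def)
    finally show ?thesis by simp
  qed
  have "vsub n w z \<in> Ubox n (1/3 * \<rho>)"
    unfolding Ubox_def
  proof (intro CollectI conjI ballI)
    fix i assume i: "i \<in> {1..n}"
    have "\<bar>z i - f i i * t i\<bar> \<le> \<rho> / 9"
      unfolding z_def by (rule order_trans[OF lincomb_near_diag[OF i] off])
    then have "\<bar>w i - z i\<bar> \<le> 1/3 * \<rho>" using diag[OF i] by linarith
    then show "\<bar>vsub n w z i\<bar> \<le> 1/3 * \<rho>" using i by (simp add: vsub_def)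
  qed simp
  moreover have "w = vadd n z (vsub n w z)"
    by (rule Rsp_eqI[OF wR]) (simp_all add: vadd_def vsub_def)
  ultimately show ?thesis using z unfolding minkowski_sum_def by blast
qed

section \<open>The excluded box, and finiteness of the cells met\<close>

lemma Ubox_subset_dom: "Ubox n \<rho> \<subseteq> fund_dom"
proof
  fix x assume "x \<in> Ubox n \<rho>"
  then have xR: "x \<in> Rsp {1..n}" and x: "\<bar>x i\<bar> \<le> \<rho>" if "i \<in> {1..n}" for i
    using that n_ge_1 by (auto simp: Ubox_def)
  have xR: "x \<in> Rsp {1..n}" using xR[of 1] n_ge_1 by simp
  have "big_sum \<rho> x = 0"
    unfolding big_sum_def using x by (intro sum.neutral) (auto simp: not_less)
  moreover have "0 \<le> kap" using zeta rho by (simp add: kap_def)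
  moreover have "\<bar>x j\<bar> \<le> f j j / 2 + \<rho> / 9" if "j \<in> {1..n}" for j
    using x[OF that] f_diag[OF that] theta rho by linarith
  moreover have "\<not> 2 * \<theta> < \<bar>x i\<bar>" if "i \<in> {1..n}" for i
    using x[OF that] theta rho by linarith
  ultimately show "x \<in> fund_dom" using xR by (auto simp: fund_dom_def)
qed

lemma Ubox_subset_cell: "Ubox n \<rho> \<subseteq> basic_cell n f"
proof
  fix x assume x: "x \<in> Ubox n \<rho>"
  have "\<bar>cf x i\<bar> < 1/2" if i: "i \<in> {1..n}" for i
  proof -
    have "(\<Sum>j=1..n. \<bar>x j\<bar>) \<le> (\<Sum>j=1..n. \<rho>)" using x by (intro sum_mono) (auto simp: Ubox_def)
    then have "C / real n * (\<Sum>j=1..n. \<bar>x j\<bar>) \<le> C / real n * (real n * \<rho>)"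
      using C_pos by (intro mult_left_mono) auto
    also have "\<dots> = C * \<rho>" using n_pos by simp
    also have "\<dots> \<le> C * \<theta>" using C_pos rho_le_theta by simp
    finally have 1: "\<bar>cf x i - N i i * x i\<bar> \<le> C * \<theta>" using cf_near_diag[OF i, of x] by linarith
    have "\<bar>N i i * x i\<bar> \<le> b * \<theta>"
      unfolding abs_mult using N_diag[OF i] a_pos x i rho_le_theta
      by (intro mult_mono) (auto simp: Ubox_def intro: order_trans)
    with 1 theta show ?thesis by linarith
  qed
  then show "x \<in> basic_cell n f" using x by (force simp: basic_cell_iff Ubox_def abs_less_iff)
qed

lemma idx_dom_finite: "\<exists>\<K>. finite \<K> \<and> idx ` fund_dom \<subseteq> \<K>"
proof -
  define m where "m = \<lceil>(\<Sum>i=1..n. \<Sum>j=1..n. \<bar>N i j\<bar> * (b / 2 + \<rho>))\<rceil> + 1"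
  have "idx ` fund_dom \<subseteq> {1..n} \<rightarrow>\<^sub>E {-m..m}"
  proof safe
    fix x assume x: "x \<in> fund_dom"
    have "idx x i \<in> {-m..m}" if i: "i \<in> {1..n}" for i
    proof -
      have "\<bar>cf x i\<bar> \<le> (\<Sum>j=1..n. \<bar>N i j\<bar> * (b / 2 + \<rho>))"
        unfolding cf_def
      proof (rule order_trans[OF sum_abs], rule sum_mono)
        fix j assume j: "j \<in> {1..n}"
        have "\<bar>x j\<bar> \<le> f j j / 2 + \<rho> / 9" using x j by (simp add: fund_dom_def)
        then have "\<bar>x j\<bar> \<le> b / 2 + \<rho>" using f_diag[OF j] rho by linarith
        then show "\<bar>N i j * x j\<bar> \<le> \<bar>N i j\<bar> * (b / 2 + \<rho>)"
          unfolding abs_mult by (intro mult_left_mono) auto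
      qed
      also have "\<dots> \<le> (\<Sum>i=1..n. \<Sum>j=1..n. \<bar>N i j\<bar> * (b / 2 + \<rho>))"
        using i b_pos rho
        by (intro member_le_sum[of i "{1..n}" "\<lambda>i. \<Sum>j=1..n. \<bar>N i j\<bar> * (b / 2 + \<rho>)"]) (auto intro!: sum_nonneg)
      finally have "\<bar>cf x i\<bar> \<le> real_of_int (m - 1)" unfolding m_def by linarith
      then have "- m \<le> \<lceil>cf x i - 1/2\<rceil>" "\<lceil>cf x i - 1/2\<rceil> \<le> m"
        by (auto simp: abs_le_iff) linarith+
      then show ?thesis using i by (simp add: idx_def)
    qed
    then show "idx x \<in> {1..n} \<rightarrow>\<^sub>E {-m..m}" by (auto simp: PiE_iff idx_def)
  qed
  moreover have "finite ({1..n} \<rightarrow>\<^sub>E {-m..m})" by (intro finite_PiE) auto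
  ultimately show ?thesis by blast
qed

section \<open>Measurability of the fundamental domain\<close>

lemma coord_measurable: "i \<in> {1..n} \<Longrightarrow> (\<lambda>x. x i) \<in> borel_measurable (Lb {1..n})"
  using measurable_component_singleton[of i "{1..n}" "\<lambda>_. lborel"] by simp

lemma Phi_shift_measurable: "(\<lambda>x. Phi (vsub n x c)) \<in> borel_measurable (Lb {1..n})"
proof -
  have "(\<lambda>x. \<Sum>i=1..n. max 0 (\<bar>x i - c i\<bar> - \<theta>)) \<in> borel_measurable (Lb {1..n})"
    using coord_measurable by (intro borel_measurable_sum borel_measurable_max borel_measurable_diff borel_measurable_abs) auto
  then show ?thesis by (simp add: Phi_def phi_def vsub_def cong: sum.cong)
qed

lemma Phi_measurable: "Phi \<in> borel_measurable (Lb {1..n})"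
proof -
  have "(\<lambda>x. \<Sum>i=1..n. max 0 (\<bar>x i\<bar> - \<theta>)) \<in> borel_measurable (Lb {1..n})"
    using coord_measurable by (intro borel_measurable_sum borel_measurable_max borel_measurable_diff borel_measurable_abs) auto
  then show ?thesis by (simp add: Phi_def[abs_def] phi_def)
qed

lemma big_sum_measurable: "big_sum r \<in> borel_measurable (Lb {1..n})"
proof -
  have "(\<lambda>x. \<Sum>i=1..n. \<bar>x i\<bar> * (if \<bar>x i\<bar> > r then 1 else 0)) \<in> borel_measurable (Lb {1..n})"
    using coord_measurable
    by (intro borel_measurable_sum borel_measurable_times borel_measurable_abs measurable_If borel_measurable_const)
       (auto intro!: borel_measurable_pred_less borel_measurable_abs simp: pred_def)
  then show ?thesis by (simp add: big_sum_def[abs_def] of_bool_def)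
qed

lemma dom_sets: "fund_dom \<in> sets (Lb {1..n})"
proof -
  have [measurable]: "Measurable.pred (Lb {1..n}) (\<lambda>x. better x k)" for k
  proof -
    note m = Phi_measurable Phi_shift_measurable[of "lp k"]
    have "{x \<in> space (Lb {1..n}). better x k} =
        {x \<in> space (Lb {1..n}). Phi x < Phi (vsub n x (lp k))} \<union>
        (if lexpos k then {x \<in> space (Lb {1..n}). Phi x = Phi (vsub n x (lp k))} else {})"
      by (auto simp: better_def)
    also have "\<dots> \<in> sets (Lb {1..n})"
      using borel_measurable_less[OF m] borel_measurable_eq[OF m] by simp
    finally show ?thesis by (simp only: pred_def)
  qed
  note [measurable] = big_sum_measurable coord_measurable
  have fin: "finite ({1..n} \<rightarrow>\<^sub>E {-1, 0, 1::int})" by (intro finite_PiE) auto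
  have "fund_dom = {x \<in> space (Lb {1..n}). big_sum \<rho> x \<le> kap \<and> (\<forall>j\<in>{1..n}. \<bar>x j\<bar> \<le> f j j / 2 + \<rho> / 9) \<and>
     (\<forall>k\<in>{1..n} \<rightarrow>\<^sub>E {-1, 0, 1}. (\<exists>i\<in>{1..n}. k i \<noteq> 0) \<longrightarrow>
        (\<forall>i\<in>{1..n}. k i \<noteq> 0 \<longrightarrow> 2 * \<theta> < \<bar>x i\<bar>) \<longrightarrow> better x k)}"
    unfolding space_Lb fund_dom_def by simp
  also have "\<dots> \<in> sets (Lb {1..n})"
    using fin by measurable
  finally show ?thesis .
qed

end

section \<open>Integration over the slices\<close>

text \<open>Test the norm on the i-th unit vector. Boundedness has to be shown first, since
  \<open>Sup\<close> of an unbounded set of reals says nothing about its elements.\<close>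

lemma diag_le_matrix_linf_norm:
  assumes i: "i \<in> {1..n}"
  shows "M i i \<le> matrix_linf_norm n M"
proof -
  let ?app = "\<lambda>x. \<lambda>i\<in>{1..n}. \<Sum>k=1..n. M i k * x k"
  let ?V = "{linf_norm n (?app x) | x. x \<in> Rsp {1..n} \<and> linf_norm n x \<le> 1}"
  have "bdd_above ?V"
  proof (rule bdd_aboveI)
    fix y assume "y \<in> ?V"
    then obtain x where x: "linf_norm n x \<le> 1" and y: "y = linf_norm n (?app x)" by auto
    have xk: "\<bar>x k\<bar> \<le> 1" if "k \<in> {1..n}" for k
      using x that by (auto simp: linf_norm_def intro: order_trans[OF Max_ge])
    have "\<bar>?app x l\<bar> \<le> (\<Sum>l=1..n. \<Sum>k=1..n. \<bar>M l k\<bar>)" if l: "l \<in> {1..n}" for l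
    proof -
      have "\<bar>?app x l\<bar> \<le> (\<Sum>k=1..n. \<bar>M l k\<bar> * \<bar>x k\<bar>)"
        using l sum_abs[of "\<lambda>k. M l k * x k" "{1..n}"] by (simp add: abs_mult)
      also have "\<dots> \<le> (\<Sum>k=1..n. \<bar>M l k\<bar> * 1)"
        by (intro sum_mono mult_left_mono xk) auto
      also have "\<dots> \<le> (\<Sum>l=1..n. \<Sum>k=1..n. \<bar>M l k\<bar>)"
        using l member_le_sum[of l "{1..n}" "\<lambda>l. \<Sum>k=1..n. \<bar>M l k\<bar>"] by (simp add: sum_nonneg)
      finally show ?thesis .
    qed
    then show "y \<le> (\<Sum>l=1..n. \<Sum>k=1..n. \<bar>M l k\<bar>)"
      unfolding y linf_norm_def using i by (intro Max.boundedI) auto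
  qed
  moreover have "linf_norm n (?app (unit_vec n i)) \<in> ?V"
    using i by (auto simp: unit_vec_def linf_norm_def intro!: exI[of _ "unit_vec n i"])
  ultimately have "linf_norm n (?app (unit_vec n i)) \<le> matrix_linf_norm n M"
    unfolding matrix_linf_norm_def by (rule cSup_upper[rotated])
  moreover have "?app (unit_vec n i) i = (\<Sum>k=1..n. M i k * (if k = i then 1 else 0))"
    using i by (auto simp: unit_vec_def intro!: sum.cong)
  then have "?app (unit_vec n i) i = M i i"
    using i by (simp add: if_distrib cong: if_cong)
  then have "\<bar>M i i\<bar> \<le> linf_norm n (?app (unit_vec n i))"
    unfolding linf_norm_def using i by (intro Max_ge) (auto intro!: image_eqI[of _ _ i])
  ultimately show ?thesis by linarith
qed

text \<open>The whole space is an affine subspace, and its parametrisation from the origin by the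
  unit vectors is the identity.\<close>

lemma measurable_within_full_space:
  assumes A: "A \<subseteq> Rsp {1..n}"
    and within: "\<And>S. affine_subspace n S \<Longrightarrow> measurable_within n S (A \<inter> S)"
  shows "A \<in> sets (leb {1..n})"
proof -
  define p :: "nat \<Rightarrow> real" where "p = (\<lambda>i\<in>{1..n}. 0)"
  have id: "vadd n p (lincomb n {1..n} t (unit_vec n)) = t" if "t \<in> Rsp {1..n}" for t
  proof (rule PiE_ext[OF _ that])
    fix i assume i: "i \<in> {1..n}"
    then have "vadd n p (lincomb n {1..n} t (unit_vec n)) i = (\<Sum>j=1..n. t j * (if i = j then 1 else 0))"
      by (simp add: vadd_def p_def lincomb_def unit_vec_def)
    then show "vadd n p (lincomb n {1..n} t (unit_vec n)) i = t i"
      using i by (simp add: if_distrib cong: if_cong)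
  qed (simp add: vadd_def)
  have "affine_subspace n (Rsp {1..n})"
    unfolding affine_subspace_def by (auto simp: PiE_eq_empty_iff)
  then have "measurable_within n (Rsp {1..n}) (A \<inter> Rsp {1..n})" by (rule within)
  moreover have "bij_betw (\<lambda>t. vadd n p (lincomb n {1..n} t (unit_vec n))) (Rsp {1..n}) (Rsp {1..n})"
    by (rule bij_betwI[where g = "\<lambda>t. t"]) (auto simp: id)
  ultimately have "{t \<in> Rsp {1..n}. vadd n p (lincomb n {1..n} t (unit_vec n)) \<in> A \<inter> Rsp {1..n}} \<in> sets (leb {1..n})"
    unfolding measurable_within_def by blast
  also have "{t \<in> Rsp {1..n}. vadd n p (lincomb n {1..n} t (unit_vec n)) \<in> A \<inter> Rsp {1..n}} = A"
    using A by (auto simp: id)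
  finally show ?thesis .
qed

text \<open>There are n choose j, hence at most n^j, sets J of size j: the origin of the factor n^j
  in the theorem.\<close>

lemma sum_nonempty_subsets_le:
  fixes h :: "nat \<Rightarrow> real"
  assumes h: "\<And>j. j \<in> {1..n} \<Longrightarrow> 0 \<le> h j"
  shows "(\<Sum>J\<in>Pow {1..n} - {{}}. h (card J)) \<le> (\<Sum>j=1..n. real n ^ j * h j)"
proof -
  let ?P = "Pow {1..n} - {{}} :: nat set set"
  have card: "card J \<in> {1..n}" if "J \<in> ?P" for J
  proof -
    have "finite J" "J \<noteq> {}" "J \<subseteq> {1..n}" using that by (auto intro: finite_subset)
    then show ?thesis using card_mono[of "{1..n}" J] card_gt_0_iff[of J] by auto
  qed
  have "(\<Sum>J\<in>?P. h (card J)) = (\<Sum>j\<in>{1..n}. \<Sum>J | J \<in> ?P \<and> card J = j. h (card J))"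
    by (rule sum.group[symmetric]) (auto intro!: image_subsetI card simp del: atLeastAtMost_iff)
  also have "\<dots> \<le> (\<Sum>j=1..n. real n ^ j * h j)"
  proof (rule sum_mono)
    fix j assume j: "j \<in> {1..n}"
    have eq: "{J \<in> ?P. card J = j} = {J. J \<subseteq> {1..n} \<and> card J = j}" using j by auto
    have "(\<Sum>J | J \<in> ?P \<and> card J = j. h (card J)) = real (n choose j) * h j"
      unfolding eq using n_subsets[of "{1..n}" j] by simp
    also have "real (n choose j) \<le> real n ^ j"
      using binomial_le_pow[of j n] j by (metis atLeastAtMost_iff of_nat_le_iff of_nat_power)
    finally show "(\<Sum>J | J \<in> ?P \<and> card J = j. h (card J)) \<le> real n ^ j * h j"
      using h[OF j] by (simp add: mult_right_mono)
  qed
  finally show ?thesis .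
qed

lemma emeasure_annulus_box_le:
  assumes "finite J" and r: "0 \<le> r" and s: "\<And>j. j \<in> J \<Longrightarrow> 2 * (s j - r) \<le> m" and m: "0 \<le> m"
  shows "emeasure (Lb J) (PiE J (\<lambda>j. {- s j..- r} \<union> {r..s j})) \<le> ennreal (m ^ card J)"
proof -
  have "emeasure (Lb J) (PiE J (\<lambda>j. {- s j..- r} \<union> {r..s j})) = (\<Prod>j\<in>J. emeasure lborel ({- s j..- r} \<union> {r..s j}))"
    using assms(1) by (intro lborel_family.emeasure_PiM) auto
  also have "\<dots> \<le> (\<Prod>j\<in>J. ennreal m)"
  proof (rule prod_mono_ennreal)
    fix j assume j: "j \<in> J"
    have "emeasure lborel ({- s j..- r} \<union> {r..s j}) \<le> emeasure lborel {- s j..- r} + emeasure lborel {r..s j}"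
      by (rule emeasure_subadditive) auto
    also have "\<dots> \<le> ennreal m"
    proof (cases "r \<le> s j")
      case True
      then show ?thesis using s[OF j] by (simp add: ennreal_plus[symmetric] ennreal_leI del: ennreal_plus)
    qed (use m in simp)
    finally show "emeasure lborel ({- s j..- r} \<union> {r..s j}) \<le> ennreal m" .
  qed
  also have "\<dots> = ennreal (m ^ card J)" using m by (simp add: ennreal_power)
  finally show ?thesis .
qed

section \<open>Slices of the fundamental domain as families of cuboids\<close>

context box_tiling
begin

definition slice :: "nat set \<Rightarrow> (nat \<Rightarrow> real) set" where
  "slice J = {x \<in> fund_dom. {j \<in> {1..n}. \<rho> < \<bar>x j\<bar>} = J}"

lemma slice_sets: "slice J \<in> sets (Lb {1..n})"
proof -
  note [measurable] = coord_measurable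
  have "slice J = fund_dom \<inter> {x \<in> space (Lb {1..n}). J \<subseteq> {1..n} \<and> (\<forall>j\<in>{1..n}. j \<in> J \<longleftrightarrow> \<rho> < \<bar>x j\<bar>)}"
    unfolding space_Lb by (auto simp: slice_def fund_dom_def)
  also have "\<dots> \<in> sets (Lb {1..n})"
    by (intro sets.Int dom_sets) measurable
  finally show ?thesis .
qed

lemma Ubox_sets: "Ubox n r \<in> sets (Lb {1..n})"
proof -
  note [measurable] = coord_measurable
  have "Ubox n r = {x \<in> space (Lb {1..n}). \<forall>j\<in>{1..n}. \<bar>x j\<bar> \<le> r}"
    unfolding space_Lb Ubox_def ..
  also have "\<dots> \<in> sets (Lb {1..n})" by measurable
  finally show ?thesis .
qed

lemma slice_subset:
  assumes "J \<noteq> {}"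
  shows "slice J \<subseteq> fund_dom - Ubox n \<rho>"
proof
  fix x assume x: "x \<in> slice J"
  with assms obtain j where "j \<in> {1..n}" "\<rho> < \<bar>x j\<bar>" unfolding slice_def by blast
  then have "x \<notin> Ubox n \<rho>" by (auto simp: Ubox_def not_le intro!: bexI[of _ j])
  with x show "x \<in> fund_dom - Ubox n \<rho>" by (simp add: slice_def)
qed

lemma indicator_dom_diff_eq_sum:
  fixes v :: "'b::real_vector"
  shows "indicator (fund_dom - Ubox n \<rho>) x *\<^sub>R v = (\<Sum>J\<in>Pow {1..n} - {{}}. indicator (slice J) x *\<^sub>R v)"
proof (cases "x \<in> fund_dom - Ubox n \<rho>")
  case True
  let ?J = "{j \<in> {1..n}. \<rho> < \<bar>x j\<bar>}"
  have "\<exists>j\<in>{1..n}. \<rho> < \<bar>x j\<bar>"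
    using True by (auto simp: Ubox_def fund_dom_def not_le)
  then have J: "?J \<in> Pow {1..n} - {{}}" by blast
  have "(\<Sum>J\<in>Pow {1..n} - {{}}. indicator (slice J) x *\<^sub>R v) = (\<Sum>J\<in>Pow {1..n} - {{}}. if J = ?J then v else 0)"
    using True by (intro sum.cong) (auto simp: slice_def indicator_def)
  then show ?thesis using True J by simp
next
  case False
  then have "x \<notin> slice J" if "J \<in> Pow {1..n} - {{}}" for J
    using slice_subset[of J] that by blast
  then show ?thesis using False by (simp add: indicator_def)
qed

text \<open>Both directions are instances of \<open>dom_slice_full\<close>: v and the merged point
  share the coordinates in J, and their other coordinates are at most \<rho> in absolute
  value.\<close>

lemma slice_merge:
  assumes J: "J \<subseteq> {1..n}" and w: "w \<in> Rsp J" and y: "y \<in> Rsp ({1..n} - J)"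
  defines "v \<equiv> (\<lambda>i\<in>{1..n}. if i \<in> J then w i else 0)"
  shows merge_eq_vadd: "merge J ({1..n} - J) (w, y) = vadd n v (embed_off n J y)"
    and merge_in_slice_iff: "merge J ({1..n} - J) (w, y) \<in> slice J \<longleftrightarrow>
      v \<in> slice J \<and> embed_off n J y \<in> Ubox_off n J \<rho>"
proof -
  let ?x = "merge J ({1..n} - J) (w, y)"
  have x1: "?x i = (if i \<in> J then w i else y i)" if "i \<in> {1..n}" for i
    using that by (simp add: merge_def)
  have xR: "?x \<in> Rsp {1..n}" using J by (auto simp: PiE_iff merge_def extensional_def)
  show eq: "?x = vadd n v (embed_off n J y)"
    by (rule Rsp_eqI[OF xR]) (auto simp: x1 vadd_def v_def embed_off_def)
  have vR: "v \<in> Rsp {1..n}" by (simp add: v_def)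
  have emb: "embed_off n J y \<in> Ubox_off n J \<rho> \<longleftrightarrow> (\<forall>i\<in>{1..n} - J. \<bar>y i\<bar> \<le> \<rho>)"
    using J rho by (auto simp: Ubox_off_def Ubox_def embed_off_def)
  show "?x \<in> slice J \<longleftrightarrow> v \<in> slice J \<and> embed_off n J y \<in> Ubox_off n J \<rho>"
  proof
    assume x: "?x \<in> slice J"
    then have xd: "?x \<in> fund_dom" and xJ: "\<And>i. i \<in> {1..n} \<Longrightarrow> \<rho> < \<bar>?x i\<bar> \<longleftrightarrow> i \<in> J"
      by (auto simp: slice_def)
    have "v \<in> fund_dom"
      by (rule dom_slice_full[OF xd vR]) (use xJ x1 rho in \<open>force simp: v_def\<close>)+
    moreover have "\<rho> < \<bar>v i\<bar> \<longleftrightarrow> i \<in> J" if "i \<in> {1..n}" for i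
      using xJ[OF that] x1[OF that] that rho by (auto simp: v_def)
    moreover have "\<bar>y i\<bar> \<le> \<rho>" if "i \<in> {1..n} - J" for i
      using xJ[of i] x1[of i] that by auto
    ultimately show "v \<in> slice J \<and> embed_off n J y \<in> Ubox_off n J \<rho>"
      using J unfolding emb slice_def by blast
  next
    assume *: "v \<in> slice J \<and> embed_off n J y \<in> Ubox_off n J \<rho>"
    then have vd: "v \<in> fund_dom" and vJ: "\<And>i. i \<in> {1..n} \<Longrightarrow> \<rho> < \<bar>v i\<bar> \<longleftrightarrow> i \<in> J"
      by (auto simp: slice_def)
    have yb: "\<bar>y i\<bar> \<le> \<rho>" if "i \<in> {1..n}" "i \<notin> J" for i using * that unfolding emb by auto
    have "?x \<in> fund_dom"
      by (rule dom_slice_full[OF vd xR]) (use vJ x1 yb in \<open>auto simp: v_def\<close>)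
    moreover have "\<rho> < \<bar>?x i\<bar> \<longleftrightarrow> i \<in> J" if "i \<in> {1..n}" for i
      using vJ[OF that] x1[OF that] that yb[OF that] by (auto simp: v_def)
    ultimately show "?x \<in> slice J" using J unfolding slice_def by blast
  qed
qed

lemma Ubox_off_cuboid:
  assumes J: "J \<subseteq> {1..n}" and r: "0 \<le> r"
  shows "is_cuboid n (Ubox_off n J r)"
  unfolding is_cuboid_def
proof (intro exI)
  show "Ubox_off n J r = PiE {1..n} (\<lambda>i. {(if i \<in> J then 0 else - r)..(if i \<in> J then 0 else r)})"
    using J r by (fastforce simp: Ubox_off_def Ubox_def PiE_iff abs_le_iff split: if_splits)
qed


text \<open>Under either alternative the inner integral is at most c plus the inner integral of G,
  as both are nonnegative. The sum of the two bounds therefore serves for every v without separating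
  the alternatives.\<close>

lemma slice_integral_bound:
  fixes H :: "(nat \<Rightarrow> real) \<Rightarrow> complex" and G :: "(nat \<Rightarrow> real) \<Rightarrow> real"
  assumes J: "J \<subseteq> {1..n}"
    and iH: "set_integrable (leb {1..n}) (slice J) H" and iG: "set_integrable (leb {1..n}) (slice J) G"
    and c: "0 \<le> c" and m: "\<And>i. i \<in> {1..n} \<Longrightarrow> f i i \<le> m"
    and G_nonneg: "\<And>x. 0 \<le> G x"
    and cases: "\<And>v. v \<in> slice J \<Longrightarrow> (\<And>j. j \<in> {1..n} - J \<Longrightarrow> v j = 0) \<Longrightarrow>
      cmod (integral_off n J (Ubox_off n J \<rho>) (\<lambda>y. H (vadd n v y))) \<le> c \<or>
      (\<forall>y\<in>Ubox_off n J \<rho>. cmod (H (vadd n v y)) \<le> G (vadd n v y))"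
  shows "cmod (set_lebesgue_integral (leb {1..n}) (slice J) H)
    \<le> c * m ^ card J + set_lebesgue_integral (leb {1..n}) (slice J) G"
proof -
  let ?K = "{1..n} - J"
  have un: "J \<union> ?K = {1..n}" using J by auto
  define s where "s j = f j j / 2 + \<rho> / 9" for j
  \<comment> \<open>A measurable box containing the projection of the slice to J. The removed middle
    of length 2\<rho> outweighs the slack 2\<rho>/9, so the j-th factor has measure at most
    \<open>f j j\<close>.\<close>
  define A where "A = PiE J (\<lambda>j. {- s j..- \<rho>} \<union> {\<rho>..s j})"
  have finJ: "finite J" using J by (rule finite_subset) simp
  have m0: "0 \<le> m" using m[of 1] f_diag[of 1] a_pos n_ge_1 by force
  have eA: "emeasure (Lb J) A \<le> ennreal (m ^ card J)"
    unfolding A_def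
  proof (rule emeasure_annulus_box_le[OF finJ _ _ m0])
    fix j assume "j \<in> J"
    then have "j \<in> {1..n}" using J by auto
    from m[OF this] show "2 * (s j - \<rho>) \<le> m" using rho by (simp add: s_def)
  qed (use rho in simp)
  have sA: "A \<in> sets (Lb J)"
    unfolding A_def using finJ by (intro sets_PiM_I_finite) auto
  have fA: "emeasure (Lb J) A < \<infinity>"
    using eA by (rule le_less_trans) simp
  have mA: "measure (Lb J) A \<le> m ^ card J"
    unfolding measure_def using eA m0 by (metis enn2real_ennreal enn2real_mono ennreal_less_top zero_le_power)
  define F where "F x = indicator (slice J) x *\<^sub>R H x" for x
  define Q where "Q x = indicator (slice J) x *\<^sub>R G x" for x
  have "cmod (integral\<^sup>L (leb (J \<union> ?K)) F) \<le> c * measure (Lb J) A + integral\<^sup>L (leb (J \<union> ?K)) Q"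
  proof (rule norm_integral_le_slices)
    show "integrable (leb (J \<union> ?K)) F" "integrable (leb (J \<union> ?K)) Q"
      using iH iG unfolding un set_integrable_def F_def Q_def by simp_all
    show "J \<inter> ?K = {}" "finite J" "finite ?K" using finJ by auto
    show "A \<in> sets (Lb J)" "emeasure (Lb J) A < \<infinity>" by fact+
    fix w assume w: "w \<in> Rsp J"
      and iF: "integrable (leb ?K) (\<lambda>y. F (merge J ?K (w, y)))"
      and iQ: "integrable (leb ?K) (\<lambda>y. Q (merge J ?K (w, y)))"
    define v where "v = (\<lambda>i\<in>{1..n}. if i \<in> J then w i else 0)"
    note merge = slice_merge[OF J w, folded v_def]
    have Q0: "0 \<le> (\<integral>y. Q (merge J ?K (w, y)) \<partial>leb ?K)"
      by (rule integral_nonneg_AE) (simp add: Q_def G_nonneg)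
    show "cmod (\<integral>y. F (merge J ?K (w, y)) \<partial>leb ?K)
        \<le> c * indicator A w + (\<integral>y. Q (merge J ?K (w, y)) \<partial>leb ?K)"
    proof (cases "v \<in> slice J")
      case False
      have "F (merge J ?K (w, y)) = 0" if "y \<in> Rsp ?K" for y
        using merge(2)[OF that] False by (simp add: F_def)
      then have "(\<integral>y. F (merge J ?K (w, y)) \<partial>leb ?K) = (\<integral>y. 0 \<partial>leb ?K)"
        by (intro Bochner_Integration.integral_cong) auto
      then show ?thesis using Q0 c by simp
    next
      case True
      have wA: "w \<in> A"
      proof -
        have "w j \<in> {- s j..- \<rho>} \<union> {\<rho>..s j}" if j: "j \<in> J" for j
        proof -
          have j': "j \<in> {1..n}" using j J by auto
          then have vj: "v j = w j" using j by (simp add: v_def)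
          have "\<bar>w j\<bar> \<le> s j" using True j' unfolding slice_def fund_dom_def s_def vj[symmetric] by auto
          moreover have "\<rho> < \<bar>w j\<bar>" using True j j' unfolding slice_def vj[symmetric] by auto
          ultimately show ?thesis by (auto simp: abs_le_iff)
        qed
        then show ?thesis using w unfolding A_def PiE_iff by simp
      qed
      have v0: "v j = 0" if "j \<in> {1..n} - J" for j using that by (simp add: v_def)
      from cases[OF True v0] show ?thesis
      proof
        assume le: "cmod (integral_off n J (Ubox_off n J \<rho>) (\<lambda>y. H (vadd n v y))) \<le> c"
        have "(\<integral>y. F (merge J ?K (w, y)) \<partial>leb ?K) = integral_off n J (Ubox_off n J \<rho>) (\<lambda>y. H (vadd n v y))"
          unfolding integral_off_def set_lebesgue_integral_def
        proof (rule Bochner_Integration.integral_cong[OF refl])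
          fix y assume "y \<in> space (leb ?K)"
          then have y: "y \<in> Rsp ?K" by simp
          show "F (merge J ?K (w, y)) = indicator {z \<in> Rsp ?K. embed_off n J z \<in> Ubox_off n J \<rho>} y *\<^sub>R
              H (vadd n v (embed_off n J y))"
            using merge(2)[OF y] True y unfolding F_def merge(1)[OF y] by (simp add: indicator_def)
        qed
        with le Q0 wA show ?thesis by simp
      next
        assume le: "\<forall>y\<in>Ubox_off n J \<rho>. cmod (H (vadd n v y)) \<le> G (vadd n v y)"
        have "cmod (\<integral>y. F (merge J ?K (w, y)) \<partial>leb ?K) \<le> (\<integral>y. cmod (F (merge J ?K (w, y))) \<partial>leb ?K)"
          by (rule integral_norm_bound)
        also have "\<dots> \<le> (\<integral>y. Q (merge J ?K (w, y)) \<partial>leb ?K)"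
        proof (rule integral_mono)
          fix y assume "y \<in> space (leb ?K)"
          then have y: "y \<in> Rsp ?K" by simp
          show "cmod (F (merge J ?K (w, y))) \<le> Q (merge J ?K (w, y))"
            using merge(2)[OF y] le unfolding F_def Q_def merge(1)[OF y] by (auto simp: indicator_def)
        qed (use iF iQ in auto)
        finally show ?thesis using c by (simp add: add_increasing)
      qed
    qed
  qed
  moreover have "c * measure (Lb J) A \<le> c * m ^ card J" using c mA by (rule mult_left_mono[rotated])
  ultimately show ?thesis unfolding un F_def Q_def set_lebesgue_integral_def by linarith
qed

text \<open>The box lies both in \<open>fund_dom\<close> and in the cell, so a coset meeting it has
  the same representative in both. Removing the box therefore removes the same cosets from either
  side.\<close>

lemma dom_image_cell:
  shows dom_image_subset: "cell_rep n f ` (fund_dom - Ubox n \<rho>) \<subseteq> basic_cell n f - Ubox n \<rho>"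
    and dom_image_covers: "{u \<in> basic_cell n f - Ubox n \<rho>. big_sum (\<rho> / 3) u \<le> 1/3 * \<zeta> * real n * \<rho>}
      \<subseteq> cell_rep n f ` (fund_dom - Ubox n \<rho>)"
proof -
  have dR: "x \<in> Rsp {1..n}" if "x \<in> fund_dom" for x using that by (simp add: fund_dom_def)
  show "cell_rep n f ` (fund_dom - Ubox n \<rho>) \<subseteq> basic_cell n f - Ubox n \<rho>"
  proof safe
    fix x assume x: "x \<in> fund_dom" "x \<notin> Ubox n \<rho>"
    show cell: "cell_rep n f x \<in> basic_cell n f" using dR[OF x(1)] by (rule cell_rep_in_cell)
    assume U: "cell_rep n f x \<in> Ubox n \<rho>"
    have "cell_rep n f x = x"
      by (rule dom_unique) (use U Ubox_subset_dom x cell_rep_cell[OF cell] in auto)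
    with U x show False by simp
  qed
  show "{u \<in> basic_cell n f - Ubox n \<rho>. big_sum (\<rho> / 3) u \<le> 1/3 * \<zeta> * real n * \<rho>}
      \<subseteq> cell_rep n f ` (fund_dom - Ubox n \<rho>)"
  proof safe
    fix u assume u: "u \<in> basic_cell n f" "u \<notin> Ubox n \<rho>" "big_sum (\<rho> / 3) u \<le> 1/3 * \<zeta> * real n * \<rho>"
    have uR: "u \<in> Rsp {1..n}" by (rule basic_cell_Rsp[OF u(1)])
    obtain k where k: "vsub n u (lp k) \<in> fund_dom" using dom_exists[OF uR u(3)] .
    have rep: "cell_rep n f (vsub n u (lp k)) = u"
      by (simp add: cell_rep_vsub_lp[OF uR] cell_rep_cell[OF u(1)])
    have "vsub n u (lp k) \<notin> Ubox n \<rho>"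
    proof
      assume U: "vsub n u (lp k) \<in> Ubox n \<rho>"
      then have "cell_rep n f (vsub n u (lp k)) = vsub n u (lp k)"
        using Ubox_subset_cell by (intro cell_rep_cell) auto
      with rep U u(2) show False by simp
    qed
    with k rep show "u \<in> cell_rep n f ` (fund_dom - Ubox n \<rho>)" by (metis DiffI imageI)
  qed
qed

lemma slice_meets_hypotheses:
  assumes v: "v \<in> slice J" and v0: "\<And>j. j \<in> {1..n} - J \<Longrightarrow> v j = 0"
  shows slice_near_cell: "v \<in> minkowski_sum n (basic_cell n f) (Ubox n (1/3 * \<rho>)) \<inter> span_of n J (unit_vec n)"
    and slice_large: "\<forall>j\<in>J. \<bar>v j\<bar> > \<rho> * f j j / (9 * Max ((\<lambda>k. f k k) ` {1..n}))"
proof -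
  have vd: "v \<in> fund_dom" and J: "J \<subseteq> {1..n}" and vJ: "\<And>j. j \<in> J \<Longrightarrow> \<rho> < \<bar>v j\<bar>"
    using v by (auto simp: slice_def)
  have finJ: "finite J" using J by (rule finite_subset) simp
  have "v = lincomb n J v (unit_vec n)"
  proof (rule Rsp_eqI)
    fix i assume i: "i \<in> {1..n}"
    have "lincomb n J v (unit_vec n) i = (\<Sum>j\<in>J. v j * (if i = j then 1 else 0))"
      using i by (simp add: lincomb_def unit_vec_def)
    also have "\<dots> = (if i \<in> J then v i else 0)"
      using finJ by (simp add: if_distrib cong: if_cong)
    finally show "v i = lincomb n J v (unit_vec n) i" using v0[of i] i by auto
  qed (use vd in \<open>auto simp: fund_dom_def lincomb_def\<close>)
  then have "v \<in> span_of n J (unit_vec n)" unfolding span_of_def by blast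
  moreover have "v \<in> minkowski_sum n (basic_cell n f) (Ubox n (1/3 * \<rho>))"
    by (rule dom_truncation_near_cell[OF vd]) (use v0 vJ in blast)
  ultimately show "v \<in> minkowski_sum n (basic_cell n f) (Ubox n (1/3 * \<rho>)) \<inter> span_of n J (unit_vec n)"
    by blast
  show "\<forall>j\<in>J. \<bar>v j\<bar> > \<rho> * f j j / (9 * Max ((\<lambda>k. f k k) ` {1..n}))"
  proof
    fix j assume j: "j \<in> J"
    then have j': "j \<in> {1..n}" using J by auto
    have le: "f j j \<le> Max ((\<lambda>k. f k k) ` {1..n})" using j' by (intro Max_ge) auto
    have pos: "0 < f j j" using f_diag[OF j'] a_pos by linarith
    have "\<rho> * f j j \<le> \<rho> * (9 * Max ((\<lambda>k. f k k) ` {1..n}))"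
      using le pos rho by (intro mult_left_mono) auto
    then have "\<rho> * f j j / (9 * Max ((\<lambda>k. f k k) ` {1..n})) \<le> \<rho>"
      using le pos by (simp add: field_simps)
    with vJ[OF j] show "\<bar>v j\<bar> > \<rho> * f j j / (9 * Max ((\<lambda>k. f k k) ` {1..n}))" by linarith
  qed
qed

(* The alternative "bounded by L, or inside Babs" is used slice by slice, so that the set of
   good slices, which need not be measurable, never occurs as a domain of integration. *)
lemma cell_integral_bound:
  fixes H :: "(nat \<Rightarrow> real) \<Rightarrow> complex" and Babs :: "(nat \<Rightarrow> real) set" and L :: "nat \<Rightarrow> real"
  assumes int: "set_integrable (leb {1..n}) (basic_cell n f) H"
    and periodic: "\<And>x. x \<in> Rsp {1..n} \<Longrightarrow> H x = H (cell_rep n f x)"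
    and large_in: "{x \<in> basic_cell n f. big_sum (\<rho> / 3) x > 1/3 * \<zeta> * real n * \<rho>} \<subseteq> Babs"
    and Babs: "Babs \<subseteq> basic_cell n f" "Babs \<in> sets (leb {1..n})"
    and L: "\<And>j. j \<in> {1..n} \<Longrightarrow> 0 \<le> L j"
    and slices: "\<And>J W w. J \<subseteq> {1..n} \<Longrightarrow> J \<noteq> {} \<Longrightarrow> is_cuboid n W \<Longrightarrow>
      Ubox_off n J (1/3 * \<rho>) \<subseteq> W \<Longrightarrow> W \<subseteq> Ubox_off n J (4/3 * \<rho>) \<Longrightarrow>
      w \<in> minkowski_sum n (basic_cell n f) (Ubox n (1/3 * \<rho>)) \<inter> span_of n J (unit_vec n) \<Longrightarrow>
      \<forall>j\<in>J. \<bar>w j\<bar> > \<rho> * f j j / (9 * Max ((\<lambda>k. f k k) ` {1..n})) \<Longrightarrow>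
      cell_rep n f ` minkowski_sum n {w} (Ubox_off n J (2 * \<rho>)) \<inter> (basic_cell n f - Babs) \<noteq> {} \<Longrightarrow>
      cmod (integral_off n J W (\<lambda>y. H (vadd n w y))) \<le> L (card J)"
    and m: "\<And>i. i \<in> {1..n} \<Longrightarrow> f i i \<le> m"
  shows "cmod (set_lebesgue_integral (leb {1..n}) (basic_cell n f - Ubox n \<rho>) H)
    \<le> set_lebesgue_integral (leb {1..n}) Babs (\<lambda>x. cmod (H x)) + (\<Sum>j=1..n. (real n * m) ^ j * L j)"
proof -
  let ?L = "leb {1..n}" and ?B = "basic_cell n f" and ?U = "Ubox n \<rho>" and ?\<tau> = "cell_rep n f"
  let ?PJ = "Pow {1..n} - {{}} :: nat set set"
  define D where "D = fund_dom - ?U"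
  define T where "T = ?\<tau> ` D"
  \<comment> \<open>The part of \<open>\<bar>H\<bar>\<close> over \<open>Babs\<close>, extended
    periodically through the cell representative so that it can be transported between D and T just
    like H.\<close>
  define G where "G x = cmod (H x) * indicator Babs (?\<tau> x)" for x
  have m0: "0 \<le> m" using m[of 1] f_diag[of 1] a_pos n_ge_1 by force
  have tt: "?\<tau> (?\<tau> x) = ?\<tau> x" if "x \<in> Rsp {1..n}" for x
    using that by (intro cell_rep_cell cell_rep_in_cell)
  have iBabs: "integrable ?L (\<lambda>x. indicator Babs x *\<^sub>R cmod (H x))"
  proof -
    have "integrable ?L (\<lambda>x. indicator Babs x *\<^sub>R cmod (indicator ?B x *\<^sub>R H x))"
      using int unfolding set_integrable_def
      by (rule integrable_mult_indicator[OF Babs(2) integrable_norm])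
    also have "(\<lambda>x. indicator Babs x *\<^sub>R cmod (indicator ?B x *\<^sub>R H x)) = (\<lambda>x. indicator Babs x *\<^sub>R cmod (H x))"
      using Babs(1) by (intro ext) (auto simp: indicator_def)
    finally show ?thesis .
  qed
  have iG: "set_integrable ?L ?B G"
  proof -
    have "(\<lambda>x. indicator ?B x *\<^sub>R G x) = (\<lambda>x. indicator Babs x *\<^sub>R cmod (H x))"
      using Babs(1) by (intro ext) (auto simp: indicator_def G_def cell_rep_cell)
    then show ?thesis unfolding set_integrable_def using iBabs by simp
  qed
  have D_sets: "D \<in> sets (Lb {1..n})" unfolding D_def by (intro sets.Diff dom_sets Ubox_sets)
  obtain \<K> where K: "finite \<K>" "idx ` D \<subseteq> \<K>" using idx_dom_finite by (auto simp: D_def)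
  have D_inj: "x = y" if "x \<in> D" "y \<in> D" "?\<tau> x = ?\<tau> y" for x y
    using that by (auto simp: D_def intro: dom_unique)
  have Hp: "H (?\<tau> x) = H x" if "x \<in> Rsp {1..n}" for x using periodic[OF that] by simp
  have Gp: "G (?\<tau> x) = G x" if "x \<in> Rsp {1..n}" for x using Hp[OF that] tt[OF that] by (simp add: G_def)
  have T_sets: "T \<in> sets (Lb {1..n})"
    unfolding T_def by (rule cell_rep_image_sets) (fact Hp int D_sets K D_inj)+
  have iDH: "set_integrable ?L D H"
    by (rule set_integrable_transversal) (fact Hp int D_sets K D_inj)+
  have iDG: "set_integrable ?L D G"
    by (rule set_integrable_transversal) (fact Gp iG D_sets K D_inj)+
  have DH: "set_lebesgue_integral ?L D H = set_lebesgue_integral ?L T H"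
    unfolding T_def by (rule set_integral_transversal) (fact Hp int D_sets K D_inj)+
  have DG: "set_lebesgue_integral ?L D G = set_lebesgue_integral ?L T G"
    unfolding T_def by (rule set_integral_transversal) (fact Gp iG D_sets K D_inj)+
  have slice_dom: "slice J \<subseteq> D" if "J \<in> ?PJ" for J
    unfolding D_def by (rule slice_subset) (use that in simp)
  have iHs: "set_integrable ?L (slice J) H" if "J \<in> ?PJ" for J
    by (rule set_integrable_subset[OF iDH sets_leb_I[OF slice_sets] slice_dom[OF that]])
  have iGs: "set_integrable ?L (slice J) G" if "J \<in> ?PJ" for J
    by (rule set_integrable_subset[OF iDG sets_leb_I[OF slice_sets] slice_dom[OF that]])

  have per_slice: "cmod (set_lebesgue_integral ?L (slice J) H)
      \<le> L (card J) * m ^ card J + set_lebesgue_integral ?L (slice J) G" if JP: "J \<in> ?PJ" for J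
  proof (rule slice_integral_bound)
    show J: "J \<subseteq> {1..n}" using JP by auto
    show "set_integrable ?L (slice J) H" "set_integrable ?L (slice J) G" by (rule iHs[OF JP], rule iGs[OF JP])
    have finJ: "finite J" using J by (rule finite_subset) simp
    have "card J \<in> {1..n}"
      using finJ JP card_mono[OF _ J] card_gt_0_iff[of J] by auto
    then show "0 \<le> L (card J)" by (rule L)
    show "f i i \<le> m" if "i \<in> {1..n}" for i using that by (rule m)
    show "0 \<le> G x" for x by (simp add: G_def)
    fix v assume v: "v \<in> slice J" and v0: "\<And>j. j \<in> {1..n} - J \<Longrightarrow> v j = 0"
    \<comment> \<open>The hypothesis on cuboids is applied to the box of radius \<rho>. If its
      condition (ii) fails, every point of v + U_J(2\<rho>), and so of the cuboid, has its
      representative in \<open>Babs\<close>, where G equals the modulus of H.\<close>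
    let ?W = "Ubox_off n J \<rho>"
    show "cmod (integral_off n J ?W (\<lambda>y. H (vadd n v y))) \<le> L (card J) \<or>
      (\<forall>y\<in>?W. cmod (H (vadd n v y)) \<le> G (vadd n v y))"
    proof (cases "?\<tau> ` minkowski_sum n {v} (Ubox_off n J (2 * \<rho>)) \<inter> (?B - Babs) = {}")
      case False
      have "cmod (integral_off n J ?W (\<lambda>y. H (vadd n v y))) \<le> L (card J)"
      proof (rule slices[OF J _ _ _ _ slice_near_cell[OF v v0] slice_large[OF v v0] False])
        show "J \<noteq> {}" using JP by auto
        show "is_cuboid n ?W" using J rho by (intro Ubox_off_cuboid) auto
        show "Ubox_off n J (1/3 * \<rho>) \<subseteq> ?W" "?W \<subseteq> Ubox_off n J (4/3 * \<rho>)"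
          using rho by (fastforce simp: Ubox_off_def Ubox_def)+
      qed
      then show ?thesis ..
    next
      case True
      have "cmod (H (vadd n v y)) \<le> G (vadd n v y)" if y: "y \<in> ?W" for y
      proof -
        have "y \<in> Ubox_off n J (2 * \<rho>)" using y rho by (fastforce simp: Ubox_off_def Ubox_def)
        then have "vadd n v y \<in> minkowski_sum n {v} (Ubox_off n J (2 * \<rho>))"
          unfolding minkowski_sum_def by blast
        moreover have "?\<tau> (vadd n v y) \<in> ?B" by (rule cell_rep_in_cell) simp
        ultimately have "?\<tau> (vadd n v y) \<in> Babs" using True by blast
        then show ?thesis by (simp add: G_def)
      qed
      then show ?thesis by blast
    qed
  qed

  have sumH: "set_lebesgue_integral ?L D H = (\<Sum>J\<in>?PJ. set_lebesgue_integral ?L (slice J) H)"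
    unfolding set_lebesgue_integral_def D_def indicator_dom_diff_eq_sum
    using iHs unfolding set_integrable_def by (intro Bochner_Integration.integral_sum) auto
  have sumG: "set_lebesgue_integral ?L D G = (\<Sum>J\<in>?PJ. set_lebesgue_integral ?L (slice J) G)"
    unfolding set_lebesgue_integral_def D_def indicator_dom_diff_eq_sum
    using iGs unfolding set_integrable_def by (intro Bochner_Integration.integral_sum) auto
  have "cmod (set_lebesgue_integral ?L T H) \<le> (\<Sum>J\<in>?PJ. cmod (set_lebesgue_integral ?L (slice J) H))"
    unfolding DH[symmetric] sumH by (rule norm_sum)
  also have "\<dots> \<le> (\<Sum>J\<in>?PJ. L (card J) * m ^ card J + set_lebesgue_integral ?L (slice J) G)"
    by (rule sum_mono[OF per_slice])
  also have "\<dots> = (\<Sum>J\<in>?PJ. L (card J) * m ^ card J) + set_lebesgue_integral ?L T G"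
    by (simp add: sum.distrib sumG DG[symmetric])
  also have "(\<Sum>J\<in>?PJ. L (card J) * m ^ card J) \<le> (\<Sum>j=1..n. real n ^ j * (L j * m ^ j))"
    using L m0 by (intro sum_nonempty_subsets_le) auto
  also have "\<dots> = (\<Sum>j=1..n. (real n * m) ^ j * L j)"
    by (intro sum.cong) (auto simp: power_mult_distrib)
  finally have main: "cmod (set_lebesgue_integral ?L T H)
      \<le> (\<Sum>j=1..n. (real n * m) ^ j * L j) + set_lebesgue_integral ?L T G" by simp

  \<comment> \<open>The cell points outside the box that no representative reaches: by
    \<open>dom_image_covers\<close> they have a large \<open>big_sum\<close>, hence lie in
    \<open>Babs\<close>.\<close>
  define R where "R = ?B - ?U - T"
  have T_sub: "T \<subseteq> ?B - ?U" unfolding T_def D_def by (rule dom_image_subset)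
  have R_sub: "R \<subseteq> Babs"
  proof
    fix x assume x: "x \<in> R"
    show "x \<in> Babs"
    proof (cases "big_sum (\<rho> / 3) x \<le> 1/3 * \<zeta> * real n * \<rho>")
      case True
      then have "x \<in> T" using x dom_image_covers unfolding R_def T_def D_def by blast
      with x show ?thesis by (simp add: R_def)
    next
      case False
      then show ?thesis using x large_in unfolding R_def not_le by blast
    qed
  qed
  have sets: "?B - ?U \<in> sets ?L" "T \<in> sets ?L" "R \<in> sets ?L"
    unfolding R_def using T_sets basic_cell_sets Ubox_sets by (auto intro!: sets_leb_I)
  have iT: "set_integrable ?L T H" by (rule set_integrable_subset[OF int sets(2)]) (use T_sub in auto)
  have iR: "set_integrable ?L R H" by (rule set_integrable_subset[OF int sets(3)]) (auto simp: R_def)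
  have iTG: "set_integrable ?L T G" by (rule set_integrable_subset[OF iG sets(2)]) (use T_sub in auto)
  have "set_lebesgue_integral ?L (?B - ?U) H = set_lebesgue_integral ?L T H + set_lebesgue_integral ?L R H"
  proof -
    have "?B - ?U = T \<union> R" "T \<inter> R = {}" using T_sub by (auto simp: R_def)
    then show ?thesis using set_integral_Un[OF _ iT iR] by simp
  qed
  then have "cmod (set_lebesgue_integral ?L (?B - ?U) H)
      \<le> cmod (set_lebesgue_integral ?L T H) + cmod (set_lebesgue_integral ?L R H)"
    by (simp add: norm_triangle_ineq)
  moreover have "cmod (set_lebesgue_integral ?L R H) \<le> (\<integral>x. indicator R x *\<^sub>R cmod (H x) \<partial>?L)"
    unfolding set_lebesgue_integral_def
    using integral_norm_bound[of ?L "\<lambda>x. indicator R x *\<^sub>R H x"] by simp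
  \<comment> \<open>R and T are disjoint and G is supported over \<open>Babs\<close>, so the two
    error terms share a single integral over \<open>Babs\<close>.\<close>
  moreover have "(\<integral>x. indicator R x *\<^sub>R cmod (H x) \<partial>?L) + set_lebesgue_integral ?L T G
      \<le> set_lebesgue_integral ?L Babs (\<lambda>x. cmod (H x))"
  proof -
    have iR': "integrable ?L (\<lambda>x. indicator R x *\<^sub>R cmod (H x))"
      using integrable_norm[OF iR[unfolded set_integrable_def]] by simp
    have "(\<integral>x. indicator R x *\<^sub>R cmod (H x) \<partial>?L) + set_lebesgue_integral ?L T G
        = (\<integral>x. indicator R x *\<^sub>R cmod (H x) + indicator T x *\<^sub>R G x \<partial>?L)"
      using iR' iTG unfolding set_lebesgue_integral_def set_integrable_def by simp
    also have "\<dots> \<le> set_lebesgue_integral ?L Babs (\<lambda>x. cmod (H x))"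
      unfolding set_lebesgue_integral_def
    proof (rule integral_mono)
      fix x
      have "x \<in> T \<Longrightarrow> ?\<tau> x = x" using T_sub by (auto intro: cell_rep_cell)
      then show "indicator R x *\<^sub>R cmod (H x) + indicator T x *\<^sub>R G x \<le> indicator Babs x *\<^sub>R cmod (H x)"
        using R_sub by (auto simp: indicator_def G_def R_def)
    qed (use iR' iTG iBabs in \<open>auto simp: set_integrable_def\<close>)
    finally show ?thesis .
  qed
  ultimately show ?thesis using main by linarith
qed

end

theorem theoremB1:
  fixes C a b :: real
  assumes "0 < C" and "0 < a" and "a \<le> b"
  shows "\<exists>\<epsilon>>0. \<forall>(n::nat) (f :: nat \<Rightarrow> nat \<Rightarrow> real) (M :: nat \<Rightarrow> nat \<Rightarrow> real)
            (N :: nat \<Rightarrow> nat \<Rightarrow> real) (B :: (nat \<Rightarrow> real) set)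
            (\<zeta>::real) (\<rho>::real) (H :: (nat \<Rightarrow> real) \<Rightarrow> complex)
            (Babs :: (nat \<Rightarrow> real) set) (L :: nat \<Rightarrow> real).
      n \<ge> 1 \<longrightarrow>
      is_basis n f \<longrightarrow>
      M = col_matrix f \<longrightarrow>
      is_inverse_matrix n M N \<longrightarrow>
      B = basic_cell n f \<longrightarrow>
      entry_bounds n C a b M \<longrightarrow>
      entry_bounds n C a b N \<longrightarrow>
      0 < \<zeta> \<and> \<zeta> < \<epsilon> \<longrightarrow>
      0 < \<rho> \<and> \<rho> < \<epsilon> \<longrightarrow>
      set_integrable (leb {1..n}) B H \<longrightarrow>
      (\<forall>x\<in>Rsp {1..n}. H x = H (cell_rep n f x)) \<longrightarrow>
      {x \<in> B. (\<Sum>j=1..n. \<bar>x j\<bar> * of_bool (\<bar>x j\<bar> > \<rho> / 3)) > 1/3 * \<zeta> * real n * \<rho>}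
        \<subseteq> Babs \<longrightarrow>
      Babs \<subseteq> B \<longrightarrow>
      (\<forall>S. affine_subspace n S \<longrightarrow> measurable_within n S (Babs \<inter> S)) \<longrightarrow>
      (\<forall>j\<in>{1..n}. 0 \<le> L j) \<longrightarrow>
      (\<forall>J W w.
         J \<subseteq> {1..n} \<and> 1 \<le> card J \<and> card J \<le> n \<and>
         is_cuboid n W \<and> Ubox_off n J (1/3 * \<rho>) \<subseteq> W \<and> W \<subseteq> Ubox_off n J (4/3 * \<rho>) \<and>
         w \<in> minkowski_sum n B (Ubox n (1/3 * \<rho>)) \<inter> span_of n J (unit_vec n) \<and>
         (\<forall>j\<in>J. \<bar>w j\<bar> > \<rho> * M j j / (9 * Max ((\<lambda>k. M k k) ` {1..n}))) \<and>
         cell_rep n f ` minkowski_sum n {w} (Ubox_off n J (2 * \<rho>)) \<inter> (B - Babs) \<noteq> {}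
         \<longrightarrow> cmod (integral_off n J W (\<lambda>y. H (vadd n w y))) \<le> L (card J)) \<longrightarrow>
      cmod (set_lebesgue_integral (leb {1..n}) (B - Ubox n \<rho>) H)
        \<le> set_lebesgue_integral (leb {1..n}) Babs (\<lambda>x. cmod (H x))
          + (\<Sum>j=1..n. (real n * matrix_linf_norm n M) ^ j * L j)"
proof -
  have b0: "0 < b" using assms by linarith
  \<comment> \<open>This \<theta>, and with it \<epsilon>, is built from C, a and b alone, which
    makes the result uniform in n.\<close>
  define \<theta> where "\<theta> = min (a / 8) (min (1 / (16 * C)) (1 / (8 * b)))"
  have th: "0 < \<theta>" "8 * \<theta> \<le> a" "16 * C * \<theta> \<le> 1" "8 * b * \<theta> \<le> 1"
  proof -
    show "0 < \<theta>" using assms b0 by (simp add: \<theta>_def)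
    have "\<theta> \<le> a / 8" "\<theta> \<le> 1 / (16 * C)" "\<theta> \<le> 1 / (8 * b)" by (simp_all add: \<theta>_def)
    then show "8 * \<theta> \<le> a" "16 * C * \<theta> \<le> 1" "8 * b * \<theta> \<le> 1"
      using assms b0 by (simp_all add: field_simps)
  qed
  define \<epsilon> where "\<epsilon> = min (\<theta> / 4) (min 1 (min (1 / (72 * b * C)) (\<theta> / (36 * C))))"
  have eps: "0 < \<epsilon>" using th(1) assms b0 by (simp add: \<epsilon>_def)
  have small: "4 * x \<le> \<theta>" "x \<le> 1" "72 * b * C * x \<le> 1" "36 * C * x \<le> \<theta>" if "x < \<epsilon>" for x
  proof -
    have "x \<le> \<theta> / 4" "x \<le> 1 / (72 * b * C)" "x \<le> \<theta> / (36 * C)" "x \<le> 1"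
      using that by (simp_all add: \<epsilon>_def)
    then show "4 * x \<le> \<theta>" "x \<le> 1" "72 * b * C * x \<le> 1" "36 * C * x \<le> \<theta>"
      using assms b0 by (simp_all add: field_simps)
  qed
  show ?thesis
  proof (intro exI[of _ \<epsilon>] conjI allI impI)
    show "0 < \<epsilon>" by (rule eps)
  next
    fix n :: nat and f M N :: "nat \<Rightarrow> nat \<Rightarrow> real" and B :: "(nat \<Rightarrow> real) set" and \<zeta> \<rho> :: real
      and H :: "(nat \<Rightarrow> real) \<Rightarrow> complex" and Babs :: "(nat \<Rightarrow> real) set" and L :: "nat \<Rightarrow> real"
    assume n: "1 \<le> n" and "is_basis n f" and M: "M = col_matrix f" and inv: "is_inverse_matrix n M N"
      and B: "B = basic_cell n f" and entM: "entry_bounds n C a b M" and entN: "entry_bounds n C a b N"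
      and zeta: "0 < \<zeta> \<and> \<zeta> < \<epsilon>" and rho: "0 < \<rho> \<and> \<rho> < \<epsilon>"
      and int: "set_integrable (leb {1..n}) B H"
      and periodic: "\<forall>x\<in>Rsp {1..n}. H x = H (cell_rep n f x)"
      and large: "{x \<in> B. (\<Sum>j=1..n. \<bar>x j\<bar> * of_bool (\<bar>x j\<bar> > \<rho> / 3)) > 1/3 * \<zeta> * real n * \<rho>} \<subseteq> Babs"
      and BabsB: "Babs \<subseteq> B"
      and within: "\<forall>S. affine_subspace n S \<longrightarrow> measurable_within n S (Babs \<inter> S)"
      and L: "\<forall>j\<in>{1..n}. 0 \<le> L j"
      and slices: "\<forall>J W w. J \<subseteq> {1..n} \<and> 1 \<le> card J \<and> card J \<le> n \<and>
         is_cuboid n W \<and> Ubox_off n J (1/3 * \<rho>) \<subseteq> W \<and> W \<subseteq> Ubox_off n J (4/3 * \<rho>) \<and>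
         w \<in> minkowski_sum n B (Ubox n (1/3 * \<rho>)) \<inter> span_of n J (unit_vec n) \<and>
         (\<forall>j\<in>J. \<bar>w j\<bar> > \<rho> * M j j / (9 * Max ((\<lambda>k. M k k) ` {1..n}))) \<and>
         cell_rep n f ` minkowski_sum n {w} (Ubox_off n J (2 * \<rho>)) \<inter> (B - Babs) \<noteq> {}
         \<longrightarrow> cmod (integral_off n J W (\<lambda>y. H (vadd n w y))) \<le> L (card J)"
    interpret box_tiling n f N C a b \<zeta> \<rho> \<theta>
    proof
      show "is_inverse_matrix n (col_matrix f) N" using inv M by simp
      show "\<bar>f j i\<bar> \<le> C / real n" if "i \<in> {1..n}" "j \<in> {1..n}" "i \<noteq> j" for i j
        using entM that by (simp add: M entry_bounds_def col_matrix_def)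
      show "a \<le> f i i \<and> f i i \<le> b" if "i \<in> {1..n}" for i
        using entM that by (simp add: M entry_bounds_def col_matrix_def)
      show "\<bar>N i j\<bar> \<le> C / real n" if "i \<in> {1..n}" "j \<in> {1..n}" "i \<noteq> j" for i j
        using entN that by (simp add: entry_bounds_def)
      show "a \<le> N i i \<and> N i i \<le> b" if "i \<in> {1..n}" for i
        using entN that by (simp add: entry_bounds_def)
      show "4 * \<rho> \<le> \<theta>" using rho by (intro small(1)) simp
      show "\<zeta> \<le> 1" "72 * b * C * \<zeta> \<le> 1" "36 * C * \<zeta> \<le> \<theta>" using zeta small by simp_all
    qed (use assms n th rho zeta in simp_all)
    show "cmod (set_lebesgue_integral (leb {1..n}) (B - Ubox n \<rho>) H)
        \<le> set_lebesgue_integral (leb {1..n}) Babs (\<lambda>x. cmod (H x))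
          + (\<Sum>j=1..n. (real n * matrix_linf_norm n M) ^ j * L j)"
      unfolding B
    proof (rule cell_integral_bound)
      show "set_integrable (leb {1..n}) (basic_cell n f) H" using int B by simp
      show "H x = H (cell_rep n f x)" if "x \<in> Rsp {1..n}" for x using periodic that by blast
      show "{x \<in> basic_cell n f. big_sum (\<rho> / 3) x > 1/3 * \<zeta> * real n * \<rho>} \<subseteq> Babs"
        using large unfolding B big_sum_def .
      show "Babs \<subseteq> basic_cell n f" using BabsB B by simp
      then show "Babs \<in> sets (leb {1..n})"
        using basic_cell_Rsp within by (intro measurable_within_full_space) blast+
      show "0 \<le> L j" if "j \<in> {1..n}" for j using L that by blast
      show "f i i \<le> matrix_linf_norm n M" if "i \<in> {1..n}" for i
        using diag_le_matrix_linf_norm[OF that, of M] by (simp add: M col_matrix_def)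
      fix J W w
      assume J: "J \<subseteq> {1..n}" "J \<noteq> {}"
        and *: "is_cuboid n W" "Ubox_off n J (1/3 * \<rho>) \<subseteq> W" "W \<subseteq> Ubox_off n J (4/3 * \<rho>)"
          "w \<in> minkowski_sum n (basic_cell n f) (Ubox n (1/3 * \<rho>)) \<inter> span_of n J (unit_vec n)"
          "\<forall>j\<in>J. \<bar>w j\<bar> > \<rho> * f j j / (9 * Max ((\<lambda>k. f k k) ` {1..n}))"
          "cell_rep n f ` minkowski_sum n {w} (Ubox_off n J (2 * \<rho>)) \<inter> (basic_cell n f - Babs) \<noteq> {}"
      have "finite J" using J(1) by (rule finite_subset) simp
      then have "1 \<le> card J" "card J \<le> n"
        using J card_mono[of "{1..n}" J] card_gt_0_iff[of J] by auto
      then show "cmod (integral_off n J W (\<lambda>y. H (vadd n w y))) \<le> L (card J)"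
        using slices[rule_format, of J W w] J(1) * unfolding B M col_matrix_def by blast
    qed
  qed
qed

end
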